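(* Let $\kappa\in\{-1,0,1\}$, let $f:\mathbb{R}\to\mathbb{R}$ be smooth, and let $\varphi:\Sigma\to\mathbb{R}\times_f\mathbb{M}^2(\kappa)$ be an isometric immersion of a complete, orientable surface with positive extrinsic curvature $K_e$, oriented by a unit normal $N$ for which the second fundamental form is positive definite. Let $z$ be a (local) conformal parameter for the second fundamental form, so that $$I=E\,dz^2+2F|dz|^2+\overline{E}\,d\overline z^2,\qquad II=2\rho|dz|^2,\quad \rho>0,$$ and put $D=|E|^2-F^2$ and $\alpha=\overline{E}h_z-Fh_{\overline z}$, where $h$ is the height function and $\nu$ the angle function. Then, with $f,f',f''$ evaluated at $h$, the following equations hold: $$\frac{\rho_{\overline z}}{\rho}+(\Gamma^1_{12}-\Gamma^2_{22})=\frac{\nu}{\rho}\,\alpha\,(f''+\kappa e^{-2f}),$$ $$\nu_z=\frac{\overline\alpha K_e}{\rho}-f'\nu h_z,$$ $$\Gamma^1_{12}=-\frac{(K_e)_{\overline z}}{4K_e}+\frac{\nu\alpha}{2\rho}(f''+\kappa e^{-2f}),$$ $$h_{zz}=\Gamma^1_{11}h_z+\Gamma^2_{11}h_{\overline z}+f'E-f'(h_z)^2,$$ $$h_{z\overline z}=\rho\nu\Big(1-\frac{(f''+\kappa e^{-2f})(1-\nu^2)}{2K_e}\Big)-\frac{1}{4K_e}\big((K_e)_{\overline z}h_z+(K_e)_zh_{\overline z}\big)-f'(F-h_{\overline z}h_z),$$ $$\alpha_z=\alpha\frac{D_z}{2D}+\frac{1}{4K_e}\big(\overline\alpha(K_e)_{\overline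 z}-\alpha(K_e)_z\big)-\rho F\nu-f'(\alpha h_z-D),$$ $$\nu_{z\overline z}=\frac{1}{4\rho}\big(\overline\alpha(K_e)_{\overline z}+\alpha(K_e)_z\big)-K_eF\nu-\frac{K_ef'}{\rho}(\alpha h_z-D)-f'\big[\nu_zh_{\overline z}+\nu h_{z\overline z}\big]-f''\nu|h_z|^2.$$
   Context: $\mathbb{M}^2(\kappa)$ is the complete simply connected surface of constant Gaussian curvature $\kappa$ with metric $d\sigma_\kappa^2$, and $\mathbb{R}\times_f\mathbb{M}^2(\kappa)$ is $\mathbb{R}\times\mathbb{M}^2(\kappa)$ with metric $dt^2+e^{2f(t)}d\sigma_\kappa^2$, Levi-Civita connection $\overline\nabla$. The shape operator $S$ of $\Sigma$ is given by $\overline\nabla_XN=-SX$; $I$ is the induced metric and $II(X,Y)=I(SX,Y)$; $K_e=\det S$. The height function is $h=\pi_1\circ\varphi$, with $\pi_1(t,q)=t$. The unit field $\xi=\partial_t$ is decomposed along $\Sigma$ as $\xi=T+\nu N$ with $T$ tangent to $\Sigma$; $\nu=\langle\xi,N\rangle$ is the angle function and $T=\operatorname{grad}h$. For $z=x+iy$ set $\partial_z=\frac12(\partial_x-i\partial_y)$, $\partial_{\overline z}=\frac12(\partial_x+i\partial_y)$; all tensors are extended complex-bilinearly, so $E=I(\partial_z,\partial_z)$, $F=I(\partial_z,\partial_{\overline z})$, $\rho=II(\partial_z,\partial_{\overline z})$, $II(\partial_z,\partial_z)=0$. Subscripts $z,\overline z$ on functions denote derivatives. $\Gamma^k_{ij}$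 are the Christoffel symbols of the Levi-Civita connection $\nabla$ of $I$ in the frame $\partial_1=\partial_z$, $\partial_2=\partial_{\overline z}$: $\nabla_{\partial_i}\partial_j=\Gamma^1_{ij}\partial_z+\Gamma^2_{ij}\partial_{\overline z}$.
   Formalization: In the equation for h_{z z̄} the last term is taken as +f'(F − h_{z̄}h_z) instead of the printed −f'(F − h_{z̄}h_z), which fails for the slice t=0 with κ=0, f(t)=−t, N=∂_t. *)

theory Defs
  imports "HOL-Analysis.Analysis"
begin

section \<open>Smooth maps and smooth surfaces\<close>

primrec Ck_on :: "nat \<Rightarrow> 'd::real_normed_vector set \<Rightarrow> ('d \<Rightarrow> 'e::real_normed_vector) \<Rightarrow> bool" where
  "Ck_on 0 S F \<longleftrightarrow> continuous_on S F"
| "Ck_on (Suc k) S F \<longleftrightarrow> (\<forall>x\<in>S. F differentiable (at x)) \<and>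
     (\<forall>v. Ck_on k S (\<lambda>x. frechet_derivative F (at x) v))"

text \<open>Only used for open sets \<open>S\<close>.\<close>

definition smooth_on :: "'d::real_normed_vector set \<Rightarrow> ('d \<Rightarrow> 'e::real_normed_vector) \<Rightarrow> bool" where
  "smooth_on S F \<longleftrightarrow> (\<forall>k. Ck_on k S F)"

text \<open>A chart of a surface is a pair \<open>(U, c)\<close> of an open set and a map into the complex plane,
  \<open>c = x + iy\<close>; real tangent vectors \<open>a \<partial>\<^sub>x + b \<partial>\<^sub>y\<close> are the complex numbers \<open>a + ib\<close>.\<close>

type_synonym 's chart = "'s set \<times> ('s \<Rightarrow> complex)"

definition chart_dom :: "'s chart \<Rightarrow> complex set" where
  "chart_dom k = snd k ` fst k"

definition in_chart :: "'s chart \<Rightarrow> ('s \<Rightarrow> 'e) \<Rightarrow> complex \<Rightarrow> 'e" where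
  "in_chart k F = F \<circ> inv_into (fst k) (snd k)"

definition smooth_atlas :: "'s::topological_space chart set \<Rightarrow> bool" where
  "smooth_atlas A \<longleftrightarrow>
     (\<Union>k\<in>A. fst k) = UNIV \<and>
     (\<forall>(U, c)\<in>A. open U \<and> open (c ` U) \<and> homeomorphism U (c ` U) c (inv_into U c)) \<and>
     (\<forall>(U, c)\<in>A. \<forall>(V, d)\<in>A. smooth_on (c ` (U \<inter> V)) (d \<circ> inv_into U c))"

definition smooth_structure :: "'s::topological_space chart set \<Rightarrow> bool" where
  "smooth_structure A \<longleftrightarrow> smooth_atlas A \<and> (\<forall>k. smooth_atlas (insert k A) \<longrightarrow> k \<in> A)"

definition det_real :: "(complex \<Rightarrow> complex) \<Rightarrow> real" where
  \<comment> \<open>determinant of a real-linear endomorphism in the real basis \<open>1, \<i>\<close>\<close>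
  "det_real L = Re (L 1) * Im (L \<i>) - Im (L 1) * Re (L \<i>)"

definition orientable_surface :: "'s::topological_space chart set \<Rightarrow> bool" where
  "orientable_surface A \<longleftrightarrow> (\<exists>B\<subseteq>A. smooth_atlas B \<and>
     (\<forall>(U, c)\<in>B. \<forall>(V, d)\<in>B. \<forall>x\<in>c ` (U \<inter> V).
        det_real (frechet_derivative (d \<circ> inv_into U c) (at x)) > 0))"


section \<open>The ambient warped product\<close>

text \<open>The standard models of the complete simply connected surfaces of curvature
  \<open>\<kappa> = 1, 0, -1\<close>, written uniformly inside \<open>\<real> \<times> \<complex> = \<real>\<^sup>3\<close>: the unit sphere of
  Euclidean space, the plane \<open>s = 1\<close>, and the sheet \<open>s > 0\<close> of the hyperboloid
  \<open>s\<^sup>2 - |w|\<^sup>2 = 1\<close> of Minkowski space. The metric is the restriction of \<open>\<kappa> ds\<^sup>2 + |dw|\<^sup>2\<close>.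
  For \<open>\<kappa> = 0\<close> this form is degenerate on \<open>\<real>\<^sup>3\<close>, but not on the tangent planes.\<close>

definition space_form :: "real \<Rightarrow> (real \<times> complex) set" where
  "space_form \<kappa> = {(s, w). s\<^sup>2 + \<kappa> * (w \<bullet> w) = 1 \<and> (\<kappa> \<le> 0 \<longrightarrow> s > 0)}"

definition space_form_tangent :: "real \<Rightarrow> real \<times> complex \<Rightarrow> (real \<times> complex) set" where
  "space_form_tangent \<kappa> q = {(a, b). fst q * a + \<kappa> * (snd q \<bullet> b) = 0}"

definition space_form_metric :: "real \<Rightarrow> real \<times> complex \<Rightarrow> real \<times> complex \<Rightarrow> real" where
  "space_form_metric \<kappa> u v = \<kappa> * (fst u * fst v) + snd u \<bullet> snd v"

type_synonym ambient = "real \<times> real \<times> complex"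

definition warped_tangent :: "real \<Rightarrow> ambient \<Rightarrow> ambient set" where
  "warped_tangent \<kappa> p = UNIV \<times> space_form_tangent \<kappa> (snd p)"

definition warped_metric :: "real \<Rightarrow> (real \<Rightarrow> real) \<Rightarrow> ambient \<Rightarrow> ambient \<Rightarrow> ambient \<Rightarrow> real" where
  "warped_metric \<kappa> f p u v =
     fst u * fst v + exp (2 * f (fst p)) * space_form_metric \<kappa> (snd u) (snd v)"

text \<open>The Levi-Civita covariant derivative \<open>\<nabla>\<^sub>u V\<close> at \<open>x\<close> of a vector field \<open>V\<close> along a map \<open>\<psi>\<close>
  into a submanifold of a vector space, with tangent spaces \<open>T p\<close> and metric \<open>g p\<close> on \<open>T p\<close>
  (\<open>g\<close> being extended to the vector space): it is the tangent vector determined by the Koszul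
  formula. The Lie bracket terms of that formula have been expanded with the flat derivative of
  the vector space. For \<open>\<psi>\<close> the identity and \<open>T p\<close> the whole vector space, this is the usual
  expression by Christoffel symbols of the metric \<open>g\<close> in a coordinate domain.\<close>

definition levi_civita ::
  "('e::real_normed_vector \<Rightarrow> 'e \<Rightarrow> 'e \<Rightarrow> real) \<Rightarrow> ('e \<Rightarrow> 'e set) \<Rightarrow>
   ('d::real_normed_vector \<Rightarrow> 'e) \<Rightarrow> ('d \<Rightarrow> 'e) \<Rightarrow> 'd \<Rightarrow> 'd \<Rightarrow> 'e" where
  "levi_civita g T \<psi> V x u =
     (let p = \<psi> x; X = frechet_derivative \<psi> (at x) u;
          Dg = (\<lambda>a b c. frechet_derivative (\<lambda>q. g q b c) (at p) a)
      in THE W. W \<in> T p \<and> (\<forall>Y\<in>T p.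
           g p W Y = g p (frechet_derivative V (at x) u) Y
                     + (Dg X (V x) Y + Dg (V x) X Y - Dg Y X (V x)) / 2))"


section \<open>Local geometry of an immersed surface\<close>

text \<open>In this section \<open>\<psi>\<close> and \<open>n\<close> are the immersion and the unit normal in a chart.\<close>

definition first_ff ::
  "real \<Rightarrow> (real \<Rightarrow> real) \<Rightarrow> (complex \<Rightarrow> ambient) \<Rightarrow> complex \<Rightarrow> complex \<Rightarrow> complex \<Rightarrow> real" where
  "first_ff \<kappa> f \<psi> x u v =
     warped_metric \<kappa> f (\<psi> x) (frechet_derivative \<psi> (at x) u) (frechet_derivative \<psi> (at x) v)"

definition shape_op ::
  "real \<Rightarrow> (real \<Rightarrow> real) \<Rightarrow> (complex \<Rightarrow> ambient) \<Rightarrow> (complex \<Rightarrow> ambient) \<Rightarrow>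
   complex \<Rightarrow> complex \<Rightarrow> complex" where
  "shape_op \<kappa> f \<psi> n x u =
     (THE w. levi_civita (warped_metric \<kappa> f) (warped_tangent \<kappa>) \<psi> n x u
             = - frechet_derivative \<psi> (at x) w)"

definition second_ff ::
  "real \<Rightarrow> (real \<Rightarrow> real) \<Rightarrow> (complex \<Rightarrow> ambient) \<Rightarrow> (complex \<Rightarrow> ambient) \<Rightarrow>
   complex \<Rightarrow> complex \<Rightarrow> complex \<Rightarrow> real" where
  "second_ff \<kappa> f \<psi> n x u v = first_ff \<kappa> f \<psi> x (shape_op \<kappa> f \<psi> n x u) v"

definition extrinsic_curvature ::
  "real \<Rightarrow> (real \<Rightarrow> real) \<Rightarrow> (complex \<Rightarrow> ambient) \<Rightarrow> (complex \<Rightarrow> ambient) \<Rightarrow> complex \<Rightarrow> real" where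
  "extrinsic_curvature \<kappa> f \<psi> n x = det_real (shape_op \<kappa> f \<psi> n x)"

definition height :: "(complex \<Rightarrow> ambient) \<Rightarrow> complex \<Rightarrow> real" where
  "height \<psi> x = fst (\<psi> x)"

definition angle ::
  "real \<Rightarrow> (real \<Rightarrow> real) \<Rightarrow> (complex \<Rightarrow> ambient) \<Rightarrow> (complex \<Rightarrow> ambient) \<Rightarrow> complex \<Rightarrow> real" where
  "angle \<kappa> f \<psi> n x = warped_metric \<kappa> f (\<psi> x) (1, 0) (n x)"


section \<open>Immersed surfaces\<close>

definition smooth_map :: "'s chart set \<Rightarrow> ('s \<Rightarrow> 'e::real_normed_vector) \<Rightarrow> bool" where
  "smooth_map A F \<longleftrightarrow> (\<forall>k\<in>A. smooth_on (chart_dom k) (in_chart k F))"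

definition immersion :: "real \<Rightarrow> 's chart set \<Rightarrow> ('s \<Rightarrow> ambient) \<Rightarrow> bool" where
  "immersion \<kappa> A \<phi> \<longleftrightarrow>
     (\<forall>p. \<phi> p \<in> UNIV \<times> space_form \<kappa>) \<and> smooth_map A \<phi> \<and>
     (\<forall>k\<in>A. \<forall>x\<in>chart_dom k. inj (frechet_derivative (in_chart k \<phi>) (at x)))"

definition unit_normal ::
  "real \<Rightarrow> (real \<Rightarrow> real) \<Rightarrow> 's chart set \<Rightarrow> ('s \<Rightarrow> ambient) \<Rightarrow> ('s \<Rightarrow> ambient) \<Rightarrow> bool" where
  "unit_normal \<kappa> f A \<phi> N \<longleftrightarrow>
     smooth_map A N \<and>
     (\<forall>p. N p \<in> warped_tangent \<kappa> (\<phi> p) \<and> warped_metric \<kappa> f (\<phi> p) (N p) (N p) = 1) \<and>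
     (\<forall>k\<in>A. \<forall>x\<in>chart_dom k. \<forall>u.
        warped_metric \<kappa> f (in_chart k \<phi> x) (in_chart k N x)
          (frechet_derivative (in_chart k \<phi>) (at x) u) = 0)"

definition positive_extrinsic_curvature ::
  "real \<Rightarrow> (real \<Rightarrow> real) \<Rightarrow> 's chart set \<Rightarrow> ('s \<Rightarrow> ambient) \<Rightarrow> ('s \<Rightarrow> ambient) \<Rightarrow> bool" where
  "positive_extrinsic_curvature \<kappa> f A \<phi> N \<longleftrightarrow> (\<forall>k\<in>A. \<forall>x\<in>chart_dom k.
     extrinsic_curvature \<kappa> f (in_chart k \<phi>) (in_chart k N) x > 0)"

definition second_ff_pos_def ::
  "real \<Rightarrow> (real \<Rightarrow> real) \<Rightarrow> 's chart set \<Rightarrow> ('s \<Rightarrow> ambient) \<Rightarrow> ('s \<Rightarrow> ambient) \<Rightarrow> bool" where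
  "second_ff_pos_def \<kappa> f A \<phi> N \<longleftrightarrow> (\<forall>k\<in>A. \<forall>x\<in>chart_dom k. \<forall>u. u \<noteq> 0 \<longrightarrow>
     second_ff \<kappa> f (in_chart k \<phi>) (in_chart k N) x u u > 0)"

definition piecewise_C1_curve :: "'s::topological_space chart set \<Rightarrow> (real \<Rightarrow> 's) \<Rightarrow> bool" where
  "piecewise_C1_curve A \<gamma> \<longleftrightarrow> continuous_on {0..1} \<gamma> \<and>
     (\<exists>S. finite S \<and> (\<forall>(U, c)\<in>A. (c \<circ> \<gamma>) C1_differentiable_on (({0<..<1} \<inter> \<gamma> -` U) - S)))"

text \<open>The surface carries the induced metric, \<open>I(\<gamma>', \<gamma>') = \<langle>(\<phi> \<circ> \<gamma>)', (\<phi> \<circ> \<gamma>)'\<rangle>\<close>. Lengths and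
  distances are extended nonnegative reals, so that points in different components of the surface
  have infinite distance.\<close>

definition curve_length ::
  "real \<Rightarrow> (real \<Rightarrow> real) \<Rightarrow> ('s \<Rightarrow> ambient) \<Rightarrow> (real \<Rightarrow> 's) \<Rightarrow> ennreal" where
  "curve_length \<kappa> f \<phi> \<gamma> =
     (\<integral>\<^sup>+ t \<in> {0<..<1}. ennreal (sqrt (warped_metric \<kappa> f (\<phi> (\<gamma> t))
        (vector_derivative (\<phi> \<circ> \<gamma>) (at t)) (vector_derivative (\<phi> \<circ> \<gamma>) (at t)))) \<partial>lborel)"

definition riemannian_dist ::
  "real \<Rightarrow> (real \<Rightarrow> real) \<Rightarrow> 's::topological_space chart set \<Rightarrow> ('s \<Rightarrow> ambient) \<Rightarrow> 's \<Rightarrow> 's \<Rightarrow> ennreal"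
  where
  "riemannian_dist \<kappa> f A \<phi> p q =
     (INF \<gamma>\<in>{\<gamma>. piecewise_C1_curve A \<gamma> \<and> \<gamma> 0 = p \<and> \<gamma> 1 = q}. curve_length \<kappa> f \<phi> \<gamma>)"

definition complete_surface ::
  "real \<Rightarrow> (real \<Rightarrow> real) \<Rightarrow> 's::topological_space chart set \<Rightarrow> ('s \<Rightarrow> ambient) \<Rightarrow> bool" where
  "complete_surface \<kappa> f A \<phi> \<longleftrightarrow> (\<forall>P::nat \<Rightarrow> 's.
     (\<forall>e>0. \<exists>M. \<forall>m\<ge>M. \<forall>n\<ge>M. riemannian_dist \<kappa> f A \<phi> (P m) (P n) < e) \<longrightarrow> convergent P)"

definition conformal_parameter ::
  "real \<Rightarrow> (real \<Rightarrow> real) \<Rightarrow> ('s \<Rightarrow> ambient) \<Rightarrow> ('s \<Rightarrow> ambient) \<Rightarrow> 's chart \<Rightarrow> bool" where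
  \<comment> \<open>\<open>II = 2 r |dz|\<^sup>2\<close> with \<open>r > 0\<close>, where \<open>|dz|\<^sup>2 = dx\<^sup>2 + dy\<^sup>2\<close>\<close>
  "conformal_parameter \<kappa> f \<phi> N k \<longleftrightarrow> (\<forall>x\<in>chart_dom k. \<exists>r>0. \<forall>u v.
     second_ff \<kappa> f (in_chart k \<phi>) (in_chart k N) x u v = 2 * r * (u \<bullet> v))"


section \<open>Complexified tensors and derivatives\<close>

text \<open>A complexified tangent vector \<open>P\<^sub>1 \<partial>\<^sub>x + P\<^sub>2 \<partial>\<^sub>y\<close> is the pair \<open>(P\<^sub>1, P\<^sub>2)\<close> of its complex
  coefficients.\<close>

definition d_z :: "complex \<times> complex" where "d_z = (1/2, - \<i>/2)"
definition d_zb :: "complex \<times> complex" where "d_zb = (1/2, \<i>/2)"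

definition ext1 :: "(complex \<Rightarrow> complex) \<Rightarrow> complex \<times> complex \<Rightarrow> complex" where
  "ext1 L P = fst P * L 1 + snd P * L \<i>"

definition ext2 ::
  "(complex \<Rightarrow> complex \<Rightarrow> complex) \<Rightarrow> complex \<times> complex \<Rightarrow> complex \<times> complex \<Rightarrow> complex" where
  "ext2 B P Q = ext1 (\<lambda>u. ext1 (B u) Q) P"

definition Dz :: "(complex \<Rightarrow> complex) \<Rightarrow> complex \<Rightarrow> complex" where
  "Dz G x = ext1 (frechet_derivative G (at x)) d_z"

definition Dzb :: "(complex \<Rightarrow> complex) \<Rightarrow> complex \<Rightarrow> complex" where
  "Dzb G x = ext1 (frechet_derivative G (at x)) d_zb"

text \<open>Christoffel symbols of a metric \<open>g\<close> on a coordinate domain with respect to complex frame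
  vectors \<open>P\<close>, \<open>Q\<close> with constant coefficients. The real vector \<open>w = a \<partial>\<^sub>x + b \<partial>\<^sub>y\<close> equals
  \<open>(a + ib) \<partial>\<^sub>z + (a - ib) \<partial>\<^sub>z\<^sub>b\<close>, so its coefficients are \<open>w\<close> and \<open>cnj w\<close>.\<close>

definition conn :: "(complex \<Rightarrow> complex \<Rightarrow> complex \<Rightarrow> real) \<Rightarrow> complex \<Rightarrow> complex \<Rightarrow> complex \<Rightarrow> complex" where
  "conn g x u v = levi_civita g (\<lambda>_. UNIV) (\<lambda>y. y) (\<lambda>_. v) x u"

definition Gamma1 ::
  "(complex \<Rightarrow> complex \<Rightarrow> complex \<Rightarrow> real) \<Rightarrow> complex \<times> complex \<Rightarrow> complex \<times> complex \<Rightarrow>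
   complex \<Rightarrow> complex" where
  "Gamma1 g P Q x = ext2 (conn g x) P Q"

definition Gamma2 ::
  "(complex \<Rightarrow> complex \<Rightarrow> complex \<Rightarrow> real) \<Rightarrow> complex \<times> complex \<Rightarrow> complex \<times> complex \<Rightarrow>
   complex \<Rightarrow> complex" where
  "Gamma2 g P Q x = ext2 (\<lambda>u v. cnj (conn g x u v)) P Q"

end

theory Submission
  imports Defs
begin

text \<open>Along the immersion, \<open>\<nabla>\<^sub>X \<xi> = f' (X - \<langle>X, \<xi>\<rangle> \<xi>)\<close>. Splitting this into tangential and normal
  parts gives the Hessian of \<open>h\<close> and \<open>d\<nu> = - II(T, \<cdot>) - f' \<nu> dh\<close>, where \<open>T = (\<alpha> \<partial>\<^sub>z + cnj \<alpha> \<partial>\<^sub>z\<^sub>b) / D\<close>.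
  In a parameter conformal for \<open>II\<close> the Codazzi equation, whose right hand side comes from the part
  of the ambient curvature proportional to \<open>f'' + \<kappa> e\<^sup>-\<^sup>2\<^sup>f\<close>, is the first identity; together with
  \<open>K = - \<rho>\<^sup>2 / D\<close> and \<open>D\<^sub>z = 2 D (\<Gamma>\<^sup>1\<^sub>1\<^sub>1 + \<Gamma>\<^sup>2\<^sub>1\<^sub>2)\<close> it determines \<open>\<Gamma>\<^sup>1\<^sub>1\<^sub>2\<close>. The other identities follow
  by differentiating and substituting.\<close>

section \<open>Smooth maps\<close>

text \<open>\<open>levi_civita\<close> is a definite description built on the Koszul formula, so
  nothing can be computed from it before a candidate is known. The candidates \<open>nabla_n\<close>
  and \<open>nabla_\<psi>\<close> live in the vector space around the model and are then checked
  against that formula. For \<kappa> = 0 the metric form is degenerate on that space. A uniform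
  treatment of the three models therefore uses a second form, \<open>space_form_constraint\<close>,
  to express tangency, and a conormal vector that is transversal to the tangent plane in every case.
  No ambient curvature tensor is formed. The Codazzi equation is the derivative of an explicit
  formula for \<open>II\<close>: the second derivatives of the normal cancel by symmetry, f'' comes
  from differentiating the warping, and \<kappa> comes from the products of conormal corrections.
  The connection of \<open>I\<close> is real, so each Christoffel symbol with upper index 2 is the
  conjugate of one with upper index 1. In the logarithmic derivative of K this cancels \<Gamma>111,
  which is why \<Gamma>112 can be isolated.\<close>

lemma smooth_on_differentiable:
  assumes "smooth_on S F" "x \<in> S"
  shows "F differentiable (at x)"
  using assms Ck_on.simps(2)[of 0 S F] unfolding smooth_on_def by metis

lemma smooth_on_frechet:
  assumes "smooth_on S F"
  shows "smooth_on S (\<lambda>x. frechet_derivative F (at x) v)"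
  using assms unfolding smooth_on_def by (metis Ck_on.simps(2))

lemma smooth_on_continuous: "smooth_on S F \<Longrightarrow> continuous_on S F"
  unfolding smooth_on_def by (metis Ck_on.simps(1))

lemma smooth_on_has_derivative:
  assumes "smooth_on S F" "x \<in> S"
  shows "(F has_derivative frechet_derivative F (at x)) (at x)"
  using smooth_on_differentiable[OF assms] frechet_derivative_works by blast

section \<open>Symmetry of second derivatives\<close>

lemma has_real_derivative_along_line:
  fixes \<phi> :: "'a::real_normed_vector \<Rightarrow> real"
  assumes "(\<phi> has_derivative \<phi>') (at (p + a *\<^sub>R u))"
  shows "((\<lambda>a. \<phi> (p + a *\<^sub>R u)) has_real_derivative \<phi>' u) (at a)"
proof -
  have l: "linear \<phi>'" using assms has_derivative_linear by blast
  have "((\<lambda>a. p + a *\<^sub>R u) has_derivative (\<lambda>h. h *\<^sub>R u)) (at a)"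
    by (auto intro!: derivative_eq_intros)
  from has_derivative_compose[where g = \<phi>, OF this assms] show ?thesis
    by (rule has_derivative_imp_has_field_derivative) (simp add: linear_scale[OF l])
qed

text \<open>The mean value theorem applied twice: to \<open>G\<close> in the direction
  \<open>u\<close>, then to \<open>\<phi>1\<close> in the direction \<open>v\<close>. The second
  difference does not change when \<open>u\<close> and \<open>v\<close> are exchanged, which is the
  source of the symmetry.\<close>

lemma second_difference_eq:
  fixes \<phi> :: "'a::real_normed_vector \<Rightarrow> real"
  assumes d1: "\<And>y. y \<in> ball x r \<Longrightarrow> (\<phi> has_derivative \<phi>1 y) (at y)"
    and d2: "\<And>y. y \<in> ball x r \<Longrightarrow> ((\<lambda>y. \<phi>1 y u) has_derivative \<phi>2 y) (at y)"
    and s: "0 < s" "s * (norm u + norm v) < r"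
  shows "\<exists>y. norm (y - x) \<le> s * (norm u + norm v) \<and>
    \<phi> (x + s *\<^sub>R u + s *\<^sub>R v) - \<phi> (x + s *\<^sub>R u) - \<phi> (x + s *\<^sub>R v) + \<phi> x = s\<^sup>2 * \<phi>2 y v"
proof -
  have nrm: "norm (a *\<^sub>R u + b *\<^sub>R v) \<le> s * (norm u + norm v)"
    if "0 \<le> a" "a \<le> s" "0 \<le> b" "b \<le> s" for a b
  proof -
    have "norm (a *\<^sub>R u + b *\<^sub>R v) \<le> a * norm u + b * norm v"
      using norm_triangle_ineq[of "a *\<^sub>R u" "b *\<^sub>R v"] that by simp
    also have "\<dots> \<le> s * norm u + s * norm v"
      using that by (intro add_mono mult_right_mono) auto
    finally show ?thesis by (simp add: algebra_simps)
  qed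
  have inb: "x + a *\<^sub>R u + b *\<^sub>R v \<in> ball x r" if "0 \<le> a" "a \<le> s" "0 \<le> b" "b \<le> s" for a b
    using nrm[OF that] s norm_minus_cancel[of "a *\<^sub>R u + b *\<^sub>R v"]
    by (simp add: dist_norm add.assoc del: norm_minus_cancel)
  define G where "G a = \<phi> (x + a *\<^sub>R u + s *\<^sub>R v) - \<phi> (x + a *\<^sub>R u)" for a
  have G: "(G has_real_derivative (\<phi>1 (x + a *\<^sub>R u + s *\<^sub>R v) u - \<phi>1 (x + a *\<^sub>R u) u)) (at a)"
    if "0 \<le> a" "a \<le> s" for a
  proof -
    have i: "x + a *\<^sub>R u + s *\<^sub>R v \<in> ball x r" "x + a *\<^sub>R u \<in> ball x r"
      using inb[OF that, of s] inb[OF that, of 0] s by auto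
    have "((\<lambda>a. \<phi> (x + s *\<^sub>R v + a *\<^sub>R u)) has_real_derivative \<phi>1 (x + a *\<^sub>R u + s *\<^sub>R v) u) (at a)"
      by (rule has_real_derivative_along_line) (use d1[OF i(1)] in \<open>simp add: add_ac\<close>)
    moreover have "((\<lambda>a. \<phi> (x + a *\<^sub>R u)) has_real_derivative \<phi>1 (x + a *\<^sub>R u) u) (at a)"
      by (rule has_real_derivative_along_line[OF d1[OF i(2)]])
    ultimately show ?thesis
      unfolding G_def add.assoc add.commute[of "s *\<^sub>R v"] by (rule DERIV_diff)
  qed
  obtain a where a: "0 < a" "a < s" and Ga: "G s - G 0 = s * (\<phi>1 (x + a *\<^sub>R u + s *\<^sub>R v) u - \<phi>1 (x + a *\<^sub>R u) u)"
    using MVT2[OF s(1) G] by auto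
  have H: "((\<lambda>b. \<phi>1 (x + a *\<^sub>R u + b *\<^sub>R v) u) has_real_derivative \<phi>2 (x + a *\<^sub>R u + b *\<^sub>R v) v) (at b)"
    if "0 \<le> b" "b \<le> s" for b
    by (rule has_real_derivative_along_line, rule d2, rule inb) (use a that in auto)
  obtain b where b: "0 < b" "b < s" and Hb: "\<phi>1 (x + a *\<^sub>R u + s *\<^sub>R v) u - \<phi>1 (x + a *\<^sub>R u + 0 *\<^sub>R v) u
      = s * \<phi>2 (x + a *\<^sub>R u + b *\<^sub>R v) v"
    using MVT2[OF s(1) H] by auto
  show ?thesis
  proof (intro exI conjI)
    show "norm (x + a *\<^sub>R u + b *\<^sub>R v - x) \<le> s * (norm u + norm v)"
      using nrm[of a b] a b by (simp add: add.assoc)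
    show "\<phi> (x + s *\<^sub>R u + s *\<^sub>R v) - \<phi> (x + s *\<^sub>R u) - \<phi> (x + s *\<^sub>R v) + \<phi> x
        = s\<^sup>2 * \<phi>2 (x + a *\<^sub>R u + b *\<^sub>R v) v"
      using Ga Hb unfolding G_def by (simp add: power2_eq_square algebra_simps)
  qed
qed

text \<open>If the mixed derivatives differed by \<open>2 * e\<close> at \<open>x\<close>,
  continuity would keep each within \<open>e\<close> of its value there, while the common second
  difference makes them equal at two points near \<open>x\<close>.\<close>

lemma second_derivative_symmetric_real:
  fixes \<phi> :: "'a::real_normed_vector \<Rightarrow> real"
  assumes S: "open S" "x \<in> S"
    and d1: "\<And>y. y \<in> S \<Longrightarrow> (\<phi> has_derivative \<phi>1 y) (at y)"
    and d2: "\<And>y w. y \<in> S \<Longrightarrow> ((\<lambda>y. \<phi>1 y w) has_derivative \<phi>2 w y) (at y)"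
    and c: "\<And>w w'. continuous_on S (\<lambda>y. \<phi>2 w y w')"
  shows "\<phi>2 u x v = \<phi>2 v x u"
proof (rule ccontr)
  assume ne: "\<phi>2 u x v \<noteq> \<phi>2 v x u"
  define e where "e = \<bar>\<phi>2 u x v - \<phi>2 v x u\<bar> / 2"
  have e: "e > 0" using ne by (simp add: e_def)
  have close: "\<exists>d>0. \<forall>y\<in>S. dist y x < d \<longrightarrow> dist (\<phi>2 w y w') (\<phi>2 w x w') < e" for w w'
    using c[of w w'] S(2) e unfolding continuous_on_iff by blast
  obtain p q where p: "p > 0" "\<And>y. y \<in> S \<Longrightarrow> dist y x < p \<Longrightarrow> dist (\<phi>2 u y v) (\<phi>2 u x v) < e"
    and q: "q > 0" "\<And>y. y \<in> S \<Longrightarrow> dist y x < q \<Longrightarrow> dist (\<phi>2 v y u) (\<phi>2 v x u) < e"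
    using close[of u v] close[of v u] by blast
  obtain r0 where r0: "r0 > 0" "ball x r0 \<subseteq> S" using S open_contains_ball by blast
  define r where "r = min r0 (min p q)"
  have r: "r > 0" "r \<le> r0" "r \<le> p" "r \<le> q" using p q r0 by (auto simp: r_def)
  have rS: "ball x r \<subseteq> S" using r r0 by auto
  \<comment> \<open>The added 1 keeps the denominator positive and makes
    \<open>s * (norm u + norm v)\<close> strictly smaller than \<open>r\<close>.\<close>
  define s where "s = r / (norm u + norm v + 1)"
  have nn: "norm u + norm v + 1 > 0" using norm_ge_zero[of u] norm_ge_zero[of v] by linarith
  have s: "s > 0" using r nn by (simp add: s_def)
  have sr: "s * (norm u + norm v) < r"
    using r nn by (simp add: s_def field_simps)
  note diff = second_difference_eq[of x r \<phi> \<phi>1, OF d1[OF subsetD[OF rS]] d2[OF subsetD[OF rS]] s]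
  obtain y where y: "norm (y - x) \<le> s * (norm u + norm v)"
    "\<phi> (x + s *\<^sub>R u + s *\<^sub>R v) - \<phi> (x + s *\<^sub>R u) - \<phi> (x + s *\<^sub>R v) + \<phi> x = s\<^sup>2 * \<phi>2 u y v"
    using diff[OF _ _ sr] by blast
  have sr': "s * (norm v + norm u) < r" using sr by (simp add: add.commute)
  obtain y' where y': "norm (y' - x) \<le> s * (norm v + norm u)"
    "\<phi> (x + s *\<^sub>R v + s *\<^sub>R u) - \<phi> (x + s *\<^sub>R v) - \<phi> (x + s *\<^sub>R u) + \<phi> x = s\<^sup>2 * \<phi>2 v y' u"
    using diff[OF _ _ sr'] by blast
  have "s\<^sup>2 * \<phi>2 u y v = s\<^sup>2 * \<phi>2 v y' u"
    using y(2) y'(2) by (simp add: algebra_simps)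
  then have eq: "\<phi>2 u y v = \<phi>2 v y' u" using s by simp
  have "dist y x < r" "dist y' x < r" using y(1) y'(1) sr by (auto simp: dist_norm add.commute)
  moreover from this have "y \<in> S" "y' \<in> S" using rS by (auto simp: dist_commute)
  ultimately have "dist (\<phi>2 u y v) (\<phi>2 u x v) < e" "dist (\<phi>2 v y' u) (\<phi>2 v x u) < e"
    using p q r by auto
  then show False using eq unfolding e_def dist_real_def by (auto simp: abs_if split: if_splits)
qed

lemma smooth_on_symmetric:
  fixes F :: "'a::real_normed_vector \<Rightarrow> 'e::euclidean_space"
  assumes F: "smooth_on S F" and S: "open S" "x \<in> S"
  shows "frechet_derivative (\<lambda>y. frechet_derivative F (at y) u) (at x) v
       = frechet_derivative (\<lambda>y. frechet_derivative F (at y) v) (at x) u"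
proof (rule euclidean_eqI)
  fix b :: 'e
  show "frechet_derivative (\<lambda>y. frechet_derivative F (at y) u) (at x) v \<bullet> b
       = frechet_derivative (\<lambda>y. frechet_derivative F (at y) v) (at x) u \<bullet> b"
  proof (rule second_derivative_symmetric_real[OF S, of "\<lambda>y. F y \<bullet> b" "\<lambda>y w. frechet_derivative F (at y) w \<bullet> b"
      "\<lambda>w y w'. frechet_derivative (\<lambda>y. frechet_derivative F (at y) w) (at y) w' \<bullet> b"])
    show "((\<lambda>y. F y \<bullet> b) has_derivative (\<lambda>w. frechet_derivative F (at y) w \<bullet> b)) (at y)" if "y \<in> S" for y
      by (rule has_derivative_inner_left[OF smooth_on_has_derivative[OF F that]])
    show "((\<lambda>y. frechet_derivative F (at y) w \<bullet> b) has_derivative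
        (\<lambda>w'. frechet_derivative (\<lambda>y. frechet_derivative F (at y) w) (at y) w' \<bullet> b)) (at y)" if "y \<in> S" for y w
      by (rule has_derivative_inner_left[OF smooth_on_has_derivative[OF smooth_on_frechet[OF F] that]])
    show "continuous_on S (\<lambda>y. frechet_derivative (\<lambda>y. frechet_derivative F (at y) w) (at y) w' \<bullet> b)" for w w'
      by (intro continuous_intros smooth_on_continuous smooth_on_frechet F)
  qed
qed

text \<open>This is how an identity that holds on an open set gets differentiated: both sides have
  the same derivative.\<close>

lemma has_derivative_congruent:
  assumes "open S" "x \<in> S" "\<And>y. y \<in> S \<Longrightarrow> F y = G y"
    and "(F has_derivative F') (at x)" "(G has_derivative G') (at x)"
  shows "F' = G'"
  using has_derivative_transform_within_open[OF assms(4,1,2,3)] assms(5) has_derivative_unique by blast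

lemma smooth_on_UNIV_deriv:
  fixes f :: "real \<Rightarrow> real"
  assumes "smooth_on UNIV f"
  shows "(f has_real_derivative deriv f y) (at y)" "smooth_on UNIV (deriv f)"
proof -
  have d: "(f has_real_derivative frechet_derivative f (at y) 1) (at y)" for y
  proof (rule has_derivative_imp_has_field_derivative[OF smooth_on_has_derivative[OF assms UNIV_I]])
    show "h * frechet_derivative f (at y) 1 = frechet_derivative f (at y) h" for h
      using linear_scale[OF linear_frechet_derivative[OF smooth_on_differentiable[OF assms UNIV_I]], of y h 1]
      by simp
  qed
  show "(f has_real_derivative deriv f y) (at y)"
    using d by (metis DERIV_imp_deriv)
  have "deriv f = (\<lambda>y. frechet_derivative f (at y) 1)"
    using d by (auto intro: DERIV_imp_deriv)
  then show "smooth_on UNIV (deriv f)"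
    using smooth_on_frechet[OF assms] by simp
qed

section \<open>Space forms and the warped product\<close>

definition space_form_constraint :: "real \<Rightarrow> real \<times> complex \<Rightarrow> real \<times> complex \<Rightarrow> real" where
  "space_form_constraint \<kappa> u v = fst u * fst v + \<kappa> * (snd u \<bullet> snd v)"

text \<open>Normal to the space form for the ambient form \<open>\<kappa> ds\<^sup>2 + |dw|\<^sup>2\<close>; the factor \<open>\<kappa>\<^sup>2\<close> only
  distinguishes \<open>\<kappa> = 0\<close>, where the position vector is not normal to the plane \<open>s = 1\<close>.\<close>

definition space_form_conormal :: "real \<Rightarrow> real \<times> complex \<Rightarrow> real \<times> complex" where
  "space_form_conormal \<kappa> q = (fst q, \<kappa>\<^sup>2 *\<^sub>R snd q)"

lemma space_form_metric_simps:
  "space_form_metric \<kappa> (u + v) w = space_form_metric \<kappa> u w + space_form_metric \<kappa> v w"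
  "space_form_metric \<kappa> w (u + v) = space_form_metric \<kappa> w u + space_form_metric \<kappa> w v"
  "space_form_metric \<kappa> (u - v) w = space_form_metric \<kappa> u w - space_form_metric \<kappa> v w"
  "space_form_metric \<kappa> w (u - v) = space_form_metric \<kappa> w u - space_form_metric \<kappa> w v"
  "space_form_metric \<kappa> (r *\<^sub>R u) w = r * space_form_metric \<kappa> u w"
  "space_form_metric \<kappa> w (r *\<^sub>R u) = r * space_form_metric \<kappa> w u"
  "space_form_metric \<kappa> (- u) w = - space_form_metric \<kappa> u w"
  "space_form_metric \<kappa> w (- u) = - space_form_metric \<kappa> w u"
  "space_form_metric \<kappa> 0 w = 0"
  "space_form_metric \<kappa> w 0 = 0"
  by (simp_all add: space_form_metric_def algebra_simps inner_simps)

lemma space_form_metric_commute: "space_form_metric \<kappa> u v = space_form_metric \<kappa> v u"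
  by (simp add: space_form_metric_def inner_commute algebra_simps)

lemma space_form_constraint_simps:
  "space_form_constraint \<kappa> (u + v) w = space_form_constraint \<kappa> u w + space_form_constraint \<kappa> v w"
  "space_form_constraint \<kappa> w (u + v) = space_form_constraint \<kappa> w u + space_form_constraint \<kappa> w v"
  "space_form_constraint \<kappa> (u - v) w = space_form_constraint \<kappa> u w - space_form_constraint \<kappa> v w"
  "space_form_constraint \<kappa> w (u - v) = space_form_constraint \<kappa> w u - space_form_constraint \<kappa> w v"
  "space_form_constraint \<kappa> (r *\<^sub>R u) w = r * space_form_constraint \<kappa> u w"
  "space_form_constraint \<kappa> w (r *\<^sub>R u) = r * space_form_constraint \<kappa> w u"
  "space_form_constraint \<kappa> w 0 = 0"
  by (simp_all add: space_form_constraint_def algebra_simps inner_simps)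

lemma space_form_constraint_commute: "space_form_constraint \<kappa> u v = space_form_constraint \<kappa> v u"
  by (simp add: space_form_constraint_def inner_commute algebra_simps)

lemma space_form_iff_constraint:
  "q \<in> space_form \<kappa> \<longleftrightarrow> space_form_constraint \<kappa> q q = 1 \<and> (\<kappa> \<le> 0 \<longrightarrow> fst q > 0)"
  by (auto simp: space_form_def space_form_constraint_def power2_eq_square)

lemma space_form_tangent_iff_constraint:
  "u \<in> space_form_tangent \<kappa> q \<longleftrightarrow> space_form_constraint \<kappa> q u = 0"
  by (cases u) (simp add: space_form_tangent_def space_form_constraint_def)

lemma has_derivative_space_form_metric:
  assumes "(u has_derivative u') (at x)" "(v has_derivative v') (at x)"
  shows "((\<lambda>x. space_form_metric \<kappa> (u x) (v x)) has_derivative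
    (\<lambda>h. space_form_metric \<kappa> (u' h) (v x) + space_form_metric \<kappa> (u x) (v' h))) (at x)"
  unfolding space_form_metric_def
  by (auto intro!: derivative_eq_intros assms simp: fun_eq_iff algebra_simps)

lemma has_derivative_space_form_constraint:
  assumes "(u has_derivative u') (at x)" "(v has_derivative v') (at x)"
  shows "((\<lambda>x. space_form_constraint \<kappa> (u x) (v x)) has_derivative
    (\<lambda>h. space_form_constraint \<kappa> (u' h) (v x) + space_form_constraint \<kappa> (u x) (v' h))) (at x)"
  unfolding space_form_constraint_def
  by (auto intro!: derivative_eq_intros assms simp: fun_eq_iff algebra_simps)

lemma space_form_metric_conormal:
  assumes "\<kappa> \<in> {-1, 0, 1}"
  shows "space_form_metric \<kappa> (space_form_conormal \<kappa> q) u = \<kappa> * space_form_constraint \<kappa> q u"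
    and "space_form_metric \<kappa> u (space_form_conormal \<kappa> q) = \<kappa> * space_form_constraint \<kappa> q u"
  using assms
  by (auto simp: space_form_metric_def space_form_conormal_def space_form_constraint_def inner_commute)

lemma space_form_constraint_conormal:
  assumes "\<kappa> \<in> {-1, 0, 1}"
  shows "space_form_constraint \<kappa> q (space_form_conormal \<kappa> q) = space_form_constraint \<kappa> q q"
  using assms by (auto simp: space_form_conormal_def space_form_constraint_def)

text \<open>Only the hyperboloid needs an argument. There s a = w . b for a tangent vector (a, b),
  and Cauchy-Schwarz with |w|^2 < s^2 yields a^2 < |b|^2: tangent vectors are spacelike.\<close>

lemma space_form_metric_pos:
  assumes \<kappa>: "\<kappa> \<in> {-1, 0, 1}" and q: "q \<in> space_form \<kappa>" and u: "u \<in> space_form_tangent \<kappa> q"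
    and "u \<noteq> 0"
  shows "space_form_metric \<kappa> u u > 0"
proof -
  obtain s w where qq: "q = (s, w)" by (cases q)
  obtain a b where uu: "u = (a, b)" by (cases u)
  consider "\<kappa> = 1" | "\<kappa> = 0" | "\<kappa> = -1" using \<kappa> by auto
  then show ?thesis
  proof cases
    case 1
    have "a * a + b \<bullet> b > 0" if "b \<noteq> 0" using that by (simp add: add_nonneg_pos)
    moreover have "a * a + b \<bullet> b > 0" if "a \<noteq> 0"
      using that by (intro add_pos_nonneg) (auto simp: zero_less_mult_iff linorder_neq_iff)
    ultimately show ?thesis using 1 \<open>u \<noteq> 0\<close> uu by (auto simp: space_form_metric_def zero_prod_def)
  next
    case 2
    then have "a = 0" using q u by (auto simp: qq uu space_form_def space_form_tangent_def)
    then show ?thesis using 2 \<open>u \<noteq> 0\<close> uu by (auto simp: space_form_metric_def zero_prod_def)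
  next
    case 3
    have s: "s\<^sup>2 = 1 + w \<bullet> w" "s > 0" and t: "s * a = w \<bullet> b"
      using q u 3 by (auto simp: qq uu space_form_def space_form_tangent_def)
    have b: "b \<noteq> 0" using t s \<open>u \<noteq> 0\<close> uu by (auto simp: zero_prod_def)
    have "s\<^sup>2 * a\<^sup>2 = (w \<bullet> b)\<^sup>2" using t by (metis power_mult_distrib)
    also have "\<dots> \<le> (w \<bullet> w) * (b \<bullet> b)" by (rule Cauchy_Schwarz_ineq)
    also have "\<dots> < s\<^sup>2 * (b \<bullet> b)" using s b by simp
    finally have "a\<^sup>2 < b \<bullet> b" using s by (simp add: mult_less_cancel_left)
    then show ?thesis using 3 uu by (simp add: space_form_metric_def power2_eq_square)
  qed
qed

lemma warped_metric_pos:
  assumes "\<kappa> \<in> {-1, 0, 1}" "snd p \<in> space_form \<kappa>" "u \<in> warped_tangent \<kappa> p" "u \<noteq> 0"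
  shows "warped_metric \<kappa> f p u u > 0"
proof (cases "snd u = 0")
  case True
  then have "fst u \<noteq> 0" using assms(4) by (simp add: prod_eq_iff)
  then show ?thesis using True
    by (auto simp: warped_metric_def space_form_metric_simps zero_less_mult_iff linorder_neq_iff)
next
  case False
  then have "space_form_metric \<kappa> (snd u) (snd u) > 0"
    using assms by (intro space_form_metric_pos) (auto simp: warped_tangent_def)
  then show ?thesis by (simp add: warped_metric_def add_nonneg_pos)
qed

text \<open>The last assumption is nondegeneracy of \<open>g\<close> on the tangent space; it gives
  the uniqueness behind the definite description.\<close>

lemma levi_civita_eqI:
  assumes "W \<in> T (\<psi> x)"
    and "\<And>Y. Y \<in> T (\<psi> x) \<Longrightarrow> g (\<psi> x) W Y = g (\<psi> x) (frechet_derivative V (at x) u) Y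
      + (frechet_derivative (\<lambda>q. g q (V x) Y) (at (\<psi> x)) (frechet_derivative \<psi> (at x) u)
        + frechet_derivative (\<lambda>q. g q (frechet_derivative \<psi> (at x) u) Y) (at (\<psi> x)) (V x)
        - frechet_derivative (\<lambda>q. g q (frechet_derivative \<psi> (at x) u) (V x)) (at (\<psi> x)) Y) / 2"
    and "\<And>W'. W' \<in> T (\<psi> x) \<Longrightarrow> (\<And>Y. Y \<in> T (\<psi> x) \<Longrightarrow> g (\<psi> x) W' Y = g (\<psi> x) W Y) \<Longrightarrow> W' = W"
  shows "levi_civita g T \<psi> V x u = W"
  unfolding levi_civita_def Let_def
proof (rule the_equality)
  show "W \<in> T (\<psi> x) \<and> (\<forall>Y\<in>T (\<psi> x). g (\<psi> x) W Y = g (\<psi> x) (frechet_derivative V (at x) u) Y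
      + (frechet_derivative (\<lambda>q. g q (V x) Y) (at (\<psi> x)) (frechet_derivative \<psi> (at x) u)
        + frechet_derivative (\<lambda>q. g q (frechet_derivative \<psi> (at x) u) Y) (at (\<psi> x)) (V x)
        - frechet_derivative (\<lambda>q. g q (frechet_derivative \<psi> (at x) u) (V x)) (at (\<psi> x)) Y) / 2)"
    using assms(1,2) by blast
next
  fix W' assume *: "W' \<in> T (\<psi> x) \<and> (\<forall>Y\<in>T (\<psi> x). g (\<psi> x) W' Y = g (\<psi> x) (frechet_derivative V (at x) u) Y
      + (frechet_derivative (\<lambda>q. g q (V x) Y) (at (\<psi> x)) (frechet_derivative \<psi> (at x) u)
        + frechet_derivative (\<lambda>q. g q (frechet_derivative \<psi> (at x) u) Y) (at (\<psi> x)) (V x)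
        - frechet_derivative (\<lambda>q. g q (frechet_derivative \<psi> (at x) u) (V x)) (at (\<psi> x)) Y) / 2)"
  show "W' = W"
  proof (rule assms(3))
    show "g (\<psi> x) W' Y = g (\<psi> x) W Y" if "Y \<in> T (\<psi> x)" for Y
      unfolding assms(2)[OF that] using * that by blast
  qed (use * in blast)
qed

lemma frechet_derivative_warped_metric:
  assumes "smooth_on UNIV f"
  shows "frechet_derivative (\<lambda>p. warped_metric \<kappa> f p b c) (at p) a
    = 2 * deriv f (fst p) * fst a * exp (2 * f (fst p)) * space_form_metric \<kappa> (snd b) (snd c)"
proof -
  have "((\<lambda>p::ambient. f (fst p)) has_derivative (\<lambda>a. fst a * deriv f (fst p))) (at p)"
    using has_derivative_compose[OF has_derivative_fst[OF has_derivative_ident]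
        smooth_on_UNIV_deriv(1)[OF assms, THEN has_field_derivative_imp_has_derivative], of p UNIV]
    by (simp add: mult.commute)
  then have "((\<lambda>p. warped_metric \<kappa> f p b c) has_derivative
    (\<lambda>a. 2 * deriv f (fst p) * fst a * exp (2 * f (fst p)) * space_form_metric \<kappa> (snd b) (snd c))) (at p)"
    unfolding warped_metric_def by (auto intro!: derivative_eq_intros)
  from frechet_derivative_at[OF this] show ?thesis by metis
qed

text \<open>The form takes the value \<open>a\<close> at (1, 0) and
  \<open>a * (a * d - b\<^sup>2)\<close> at (b, -a).\<close>

lemma det_positive_definite:
  fixes a b d :: real
  assumes "\<And>r s. r \<noteq> 0 \<or> s \<noteq> 0 \<Longrightarrow> a * r\<^sup>2 + 2 * b * r * s + d * s\<^sup>2 > 0"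
  shows "a * d - b\<^sup>2 > 0"
proof -
  have a: "a > 0" using assms[of 1 0] by simp
  have "a * b\<^sup>2 + 2 * b * b * (- a) + d * a\<^sup>2 = a * (a * d - b\<^sup>2)"
    by (simp add: power2_eq_square algebra_simps)
  then show ?thesis using assms[of b "- a"] a by (simp add: zero_less_mult_iff)
qed

section \<open>The equations of Gauss and Codazzi\<close>

locale oriented_patch =
  fixes \<kappa> :: real and f :: "real \<Rightarrow> real" and \<Omega> :: "complex set" and \<psi> n :: "complex \<Rightarrow> ambient"
  assumes \<kappa>: "\<kappa> \<in> {-1, 0, 1}"
    and smooth_f: "smooth_on UNIV f"
    and open_\<Omega>: "open \<Omega>"
    and smooth_\<psi>: "smooth_on \<Omega> \<psi>"
    and smooth_n: "smooth_on \<Omega> n"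
    and \<psi>_space_form: "x \<in> \<Omega> \<Longrightarrow> snd (\<psi> x) \<in> space_form \<kappa>"
    and n_tangent: "x \<in> \<Omega> \<Longrightarrow> n x \<in> warped_tangent \<kappa> (\<psi> x)"
    and n_unit: "x \<in> \<Omega> \<Longrightarrow> warped_metric \<kappa> f (\<psi> x) (n x) (n x) = 1"
    and n_orthogonal: "x \<in> \<Omega> \<Longrightarrow> warped_metric \<kappa> f (\<psi> x) (n x) (frechet_derivative \<psi> (at x) u) = 0"
    and inj_\<psi>: "x \<in> \<Omega> \<Longrightarrow> inj (frechet_derivative \<psi> (at x))"
begin

abbreviation "B \<equiv> space_form_metric \<kappa>"
abbreviation "C \<equiv> space_form_constraint \<kappa>"

text \<open>\<open>\<psi> = (t, q)\<close> and \<open>n = (a, p)\<close>; the numbers \<open>1\<close> and \<open>2\<close> count derivatives, the outermost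
  direction coming first.\<close>

definition "w x = exp (2 * f (fst (\<psi> x)))"
definition "f' x = deriv f (fst (\<psi> x))"
definition "f'' x = deriv (deriv f) (fst (\<psi> x))"
definition "q x = snd (\<psi> x)"
definition "t1 u x = fst (frechet_derivative \<psi> (at x) u)"
definition "q1 u x = snd (frechet_derivative \<psi> (at x) u)"
definition "t2 u v x = fst (frechet_derivative (\<lambda>y. frechet_derivative \<psi> (at y) v) (at x) u)"
definition "q2 u v x = snd (frechet_derivative (\<lambda>y. frechet_derivative \<psi> (at y) v) (at x) u)"
definition "a x = fst (n x)"
definition "p x = snd (n x)"
definition "a1 u x = fst (frechet_derivative n (at x) u)"
definition "p1 u x = snd (frechet_derivative n (at x) u)"
definition "a2 u v x = fst (frechet_derivative (\<lambda>y. frechet_derivative n (at y) v) (at x) u)"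
definition "p2 u v x = snd (frechet_derivative (\<lambda>y. frechet_derivative n (at y) v) (at x) u)"

lemmas jet_defs = q_def t1_def q1_def t2_def q2_def a_def p_def a1_def p1_def a2_def p2_def

lemma has_derivative_jets:
  assumes x: "x \<in> \<Omega>"
  shows "((\<lambda>x. fst (\<psi> x)) has_derivative (\<lambda>u. t1 u x)) (at x)"
    "(q has_derivative (\<lambda>u. q1 u x)) (at x)"
    "(t1 v has_derivative (\<lambda>u. t2 u v x)) (at x)"
    "(q1 v has_derivative (\<lambda>u. q2 u v x)) (at x)"
    "(a has_derivative (\<lambda>u. a1 u x)) (at x)"
    "(p has_derivative (\<lambda>u. p1 u x)) (at x)"
    "(a1 v has_derivative (\<lambda>u. a2 u v x)) (at x)"
    "(p1 v has_derivative (\<lambda>u. p2 u v x)) (at x)"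
  unfolding jet_defs[abs_def]
  by (intro has_derivative_fst has_derivative_snd smooth_on_has_derivative[OF _ x] smooth_on_frechet
      smooth_\<psi> smooth_n)+

lemma has_derivative_warp:
  assumes x: "x \<in> \<Omega>"
  shows "(w has_derivative (\<lambda>u. 2 * f' x * t1 u x * w x)) (at x)"
    and "(f' has_derivative (\<lambda>u. f'' x * t1 u x)) (at x)"
proof -
  have c: "((\<lambda>x. g (fst (\<psi> x))) has_derivative (\<lambda>u. deriv g (fst (\<psi> x)) * t1 u x)) (at x)"
    if "smooth_on UNIV g" for g :: "real \<Rightarrow> real"
    using has_derivative_compose[OF has_derivative_jets(1)[OF x]
        smooth_on_UNIV_deriv(1)[OF that, THEN has_field_derivative_imp_has_derivative]]
    by (simp add: mult.commute)
  show "(f' has_derivative (\<lambda>u. f'' x * t1 u x)) (at x)"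
    unfolding f'_def[abs_def] f''_def by (rule c[OF smooth_on_UNIV_deriv(2)[OF smooth_f]])
  show "(w has_derivative (\<lambda>u. 2 * f' x * t1 u x * w x)) (at x)"
    unfolding w_def[abs_def] f'_def by (auto intro!: derivative_eq_intros c smooth_f)
qed

lemma linear_jets:
  assumes x: "x \<in> \<Omega>"
  shows "t1 (r *\<^sub>R u + s *\<^sub>R v) x = r * t1 u x + s * t1 v x"
    "q1 (r *\<^sub>R u + s *\<^sub>R v) x = r *\<^sub>R q1 u x + s *\<^sub>R q1 v x"
  using linear_frechet_derivative[OF smooth_on_differentiable[OF smooth_\<psi> x]]
  by (simp_all add: t1_def q1_def linear_add linear_scale)

lemma jets_symmetric:
  assumes x: "x \<in> \<Omega>"
  shows "t2 u v x = t2 v u x" "q2 u v x = q2 v u x" "a2 u v x = a2 v u x" "p2 u v x = p2 v u x"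
  unfolding jet_defs
  using smooth_on_symmetric[OF smooth_\<psi> open_\<Omega> x, of u v] smooth_on_symmetric[OF smooth_n open_\<Omega> x, of u v]
  by simp_all

lemma w_pos: "w x > 0" by (simp add: w_def)

lemma warped_metric_eq:
  "warped_metric \<kappa> f (\<psi> x) u v = fst u * fst v + w x * B (snd u) (snd v)"
  by (simp add: warped_metric_def w_def)

text \<open>The relations \<open>C (q x) (q x) = 1\<close> and \<open>C (q x) (p x) = 0\<close> are
  differentiated along the patch. The results measure how far flat derivatives leave the tangent
  space; the conormal terms of the covariant derivatives compensate exactly that.\<close>

lemma constraint_jets:
  assumes x: "x \<in> \<Omega>"
  shows "C (q x) (q x) = 1" "C (q x) (q1 u x) = 0" "C (q x) (q2 u v x) = - C (q1 u x) (q1 v x)"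
    "C (q x) (p x) = 0" "C (q x) (p1 u x) = - C (q1 u x) (p x)"
proof -
  have 1: "C (q x) (q x) = 1" if "x \<in> \<Omega>" for x
    using \<psi>_space_form[OF that] by (simp add: space_form_iff_constraint q_def)
  then show "C (q x) (q x) = 1" using x .
  have 2: "C (q x) (q1 u x) = 0" if x: "x \<in> \<Omega>" for x u
    using has_derivative_congruent[OF open_\<Omega> x 1
        has_derivative_space_form_constraint[OF has_derivative_jets(2,2)[OF x]] has_derivative_const]
    by (simp add: fun_eq_iff space_form_constraint_commute)
  then show "C (q x) (q1 u x) = 0" using x .
  have 4: "C (q x) (p x) = 0" if "x \<in> \<Omega>" for x
    using n_tangent[OF that] by (auto simp: warped_tangent_def q_def p_def space_form_tangent_iff_constraint)
  then show "C (q x) (p x) = 0" using x .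
  show "C (q x) (q2 u v x) = - C (q1 u x) (q1 v x)"
    using has_derivative_congruent[OF open_\<Omega> x 2
        has_derivative_space_form_constraint[OF has_derivative_jets(2,4)[OF x]] has_derivative_const]
    by (simp add: fun_eq_iff eq_neg_iff_add_eq_0 add.commute)
  show "C (q x) (p1 u x) = - C (q1 u x) (p x)"
    using has_derivative_congruent[OF open_\<Omega> x 4
        has_derivative_space_form_constraint[OF has_derivative_jets(2,6)[OF x]] has_derivative_const]
    by (simp add: fun_eq_iff eq_neg_iff_add_eq_0 add.commute)
qed

text \<open>These come from unit length and orthogonality of \<open>n\<close> and their first
  derivatives. They eliminate products \<open>w x * B (p x) _\<close>, and the computations of
  \<open>II\<close> and of the Codazzi equation are arranged to contain \<open>p x\<close> in this
  shape.\<close>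

lemma normal_jets:
  assumes x: "x \<in> \<Omega>"
  shows "w x * B (p x) (p x) = 1 - a x * a x"
    "w x * B (p x) (p1 u x) = - a x * a1 u x - f' x * t1 u x * (1 - a x * a x)"
    "w x * B (p x) (q1 u x) = - a x * t1 u x"
    "w x * B (p x) (q2 u v x) = 2 * f' x * a x * t1 u x * t1 v x - a x * t2 u v x
      - a1 u x * t1 v x - w x * B (p1 u x) (q1 v x)"
proof -
  have 1: "a x * a x + w x * B (p x) (p x) = 1" if "x \<in> \<Omega>" for x
    using n_unit[OF that] by (simp add: warped_metric_eq a_def p_def)
  then show pp: "w x * B (p x) (p x) = 1 - a x * a x" using x by (simp add: algebra_simps)
  have 3: "a x * t1 u x + w x * B (p x) (q1 u x) = 0" if "x \<in> \<Omega>" for x u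
    using n_orthogonal[OF that] by (simp add: warped_metric_eq a_def p_def t1_def q1_def)
  have pq: "w x * B (p x) (q1 u x) = - a x * t1 u x" for u using 3[OF x, of u] by linarith
  then show "w x * B (p x) (q1 u x) = - a x * t1 u x" .
  note d = has_derivative_jets[OF x] has_derivative_warp[OF x] has_derivative_space_form_metric
  have "((\<lambda>x. a x * a x + w x * B (p x) (p x)) has_derivative (\<lambda>u. a x * a1 u x + a1 u x * a x
      + (w x * (B (p1 u x) (p x) + B (p x) (p1 u x)) + 2 * f' x * t1 u x * w x * B (p x) (p x)))) (at x)"
    by (intro has_derivative_add has_derivative_mult d)
  from fun_cong[OF has_derivative_congruent[OF open_\<Omega> x 1 this has_derivative_const], of u]
  have "2 * (a x * a1 u x) + 2 * (w x * B (p x) (p1 u x)) + 2 * (f' x * t1 u x * (w x * B (p x) (p x))) = 0"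
    by (simp add: space_form_metric_commute algebra_simps)
  then show "w x * B (p x) (p1 u x) = - a x * a1 u x - f' x * t1 u x * (1 - a x * a x)"
    unfolding pp by linarith
  have "((\<lambda>x. a x * t1 v x + w x * B (p x) (q1 v x)) has_derivative (\<lambda>u. a x * t2 u v x + a1 u x * t1 v x
      + (w x * (B (p1 u x) (q1 v x) + B (p x) (q2 u v x)) + 2 * f' x * t1 u x * w x * B (p x) (q1 v x)))) (at x)"
    by (intro has_derivative_add has_derivative_mult d)
  from has_derivative_congruent[OF open_\<Omega> x 3 this has_derivative_const]
  have "a x * t2 u v x + a1 u x * t1 v x + w x * B (p1 u x) (q1 v x) + w x * B (p x) (q2 u v x)
      + 2 * f' x * t1 u x * (w x * B (p x) (q1 v x)) = 0"
    by (simp add: fun_eq_iff algebra_simps)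
  then show "w x * B (p x) (q2 u v x) = 2 * f' x * a x * t1 u x * t1 v x - a x * t2 u v x
      - a1 u x * t1 v x - w x * B (p1 u x) (q1 v x)"
    unfolding pq by (simp add: algebra_simps)
qed

text \<open>The covariant derivatives of \<open>n\<close> and of the coordinate fields of \<open>\<psi>\<close>: the conormal term
  projects the flat derivative to the tangent space of the model.\<close>

definition "nabla_n u x = (a1 u x + f' x * a x * t1 u x,
  p1 u x + f' x *\<^sub>R (t1 u x *\<^sub>R p x + a x *\<^sub>R q1 u x) + C (q1 u x) (p x) *\<^sub>R space_form_conormal \<kappa> (q x))"

definition "nabla_\<psi> u v x = (t2 u v x - f' x * w x * B (q1 u x) (q1 v x),
  q2 u v x + f' x *\<^sub>R (t1 u x *\<^sub>R q1 v x + t1 v x *\<^sub>R q1 u x)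
    + C (q1 u x) (q1 v x) *\<^sub>R space_form_conormal \<kappa> (q x))"

section \<open>Tangent spaces and the ambient Levi-Civita derivative\<close>

abbreviation "d\<psi> u x \<equiv> frechet_derivative \<psi> (at x) u"
abbreviation "G x \<equiv> warped_metric \<kappa> f (\<psi> x)"

lemma d\<psi>_eq: "d\<psi> u x = (t1 u x, q1 u x)" by (simp add: t1_def q1_def)

lemma n_eq: "n x = (a x, p x)" by (simp add: a_def p_def)

lemma warped_tangent_iff: "Y \<in> warped_tangent \<kappa> (\<psi> x) \<longleftrightarrow> C (q x) (snd Y) = 0"
  by (cases Y) (simp add: warped_tangent_def space_form_tangent_iff_constraint q_def)

lemma tangent:
  assumes x: "x \<in> \<Omega>"
  shows "d\<psi> u x \<in> warped_tangent \<kappa> (\<psi> x)" "nabla_n u x \<in> warped_tangent \<kappa> (\<psi> x)"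
    "nabla_\<psi> u v x \<in> warped_tangent \<kappa> (\<psi> x)" "(1, 0) \<in> warped_tangent \<kappa> (\<psi> x)"
  by (simp_all add: warped_tangent_iff d\<psi>_eq nabla_n_def nabla_\<psi>_def space_form_constraint_simps
      constraint_jets[OF x] space_form_constraint_conormal[OF \<kappa>])

lemma G_simps:
  "G x (u + v) Y = G x u Y + G x v Y" "G x Y (u + v) = G x Y u + G x Y v"
  "G x (u - v) Y = G x u Y - G x v Y" "G x Y (u - v) = G x Y u - G x Y v"
  "G x (r *\<^sub>R u) Y = r * G x u Y" "G x Y (r *\<^sub>R u) = r * G x Y u"
  "G x (- u) Y = - G x u Y" "G x Y (- u) = - G x Y u"
  by (simp_all add: warped_metric_eq space_form_metric_simps algebra_simps)

lemma G_commute: "G x u v = G x v u"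
  by (simp add: warped_metric_eq space_form_metric_commute mult.commute)

lemma G_pos: "x \<in> \<Omega> \<Longrightarrow> Y \<in> warped_tangent \<kappa> (\<psi> x) \<Longrightarrow> Y \<noteq> 0 \<Longrightarrow> G x Y Y > 0"
  by (intro warped_metric_pos \<kappa> \<psi>_space_form)

lemma G_nondegenerate:
  assumes x: "x \<in> \<Omega>" and "W \<in> warped_tangent \<kappa> (\<psi> x)" "W' \<in> warped_tangent \<kappa> (\<psi> x)"
    and eq: "\<And>Y. Y \<in> warped_tangent \<kappa> (\<psi> x) \<Longrightarrow> G x W' Y = G x W Y"
  shows "W' = W"
proof (rule ccontr)
  assume "W' \<noteq> W"
  moreover have t: "W' - W \<in> warped_tangent \<kappa> (\<psi> x)"
    using assms(2,3) by (simp add: warped_tangent_iff space_form_constraint_simps)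
  ultimately have "G x (W' - W) (W' - W) > 0" by (intro G_pos x) auto
  then show False using eq[OF t] by (simp add: G_simps)
qed

lemma G_nabla_n_n:
  assumes x: "x \<in> \<Omega>"
  shows "G x (nabla_n u x) (n x) = 0"
proof -
  have "G x (nabla_n u x) (n x) = a x * a1 u x + f' x * a x * a x * t1 u x + w x * B (p x) (p1 u x)
     + f' x * (t1 u x * (w x * B (p x) (p x)) + a x * (w x * B (p x) (q1 u x)))"
    unfolding warped_metric_eq nabla_n_def
    by (simp add: n_eq space_form_metric_simps space_form_metric_conormal[OF \<kappa>] constraint_jets[OF x]
        space_form_metric_commute algebra_simps)
  then show ?thesis unfolding normal_jets[OF x] by (simp add: algebra_simps)
qed

lemma levi_civita_n:
  assumes x: "x \<in> \<Omega>"
  shows "levi_civita (warped_metric \<kappa> f) (warped_tangent \<kappa>) \<psi> n x u = nabla_n u x"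
proof (rule levi_civita_eqI[where T = "warped_tangent \<kappa>"])
  fix Y assume "Y \<in> warped_tangent \<kappa> (\<psi> x)"
  then have Y: "C (q x) (snd Y) = 0" by (simp add: warped_tangent_iff)
  \<comment> \<open>The factor \<open>- a x * t1 u x\<close> is kept together so that orthogonality,
    read backwards, turns it into \<open>w x * B (p x) (q1 u x)\<close>, the last Koszul
    term.\<close>
  have "G x (nabla_n u x) Y = a1 u x * fst Y - f' x * fst Y * (- a x * t1 u x)
     + w x * (B (p1 u x) (snd Y) + f' x * (t1 u x * B (p x) (snd Y) + a x * B (q1 u x) (snd Y)))"
    unfolding warped_metric_eq nabla_n_def
    by (simp add: n_eq space_form_metric_simps space_form_metric_conormal[OF \<kappa>] Y algebra_simps)
  then show "G x (nabla_n u x) Y = G x (frechet_derivative n (at x) u) Y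
      + (frechet_derivative (\<lambda>q. warped_metric \<kappa> f q (n x) Y) (at (\<psi> x)) (d\<psi> u x)
        + frechet_derivative (\<lambda>q. warped_metric \<kappa> f q (d\<psi> u x) Y) (at (\<psi> x)) (n x)
        - frechet_derivative (\<lambda>q. warped_metric \<kappa> f q (d\<psi> u x) (n x)) (at (\<psi> x)) Y) / 2"
    unfolding normal_jets(3)[OF x, symmetric] frechet_derivative_warped_metric[OF smooth_f]
    unfolding w_def[symmetric] f'_def[symmetric]
    by (simp add: warped_metric_eq jet_defs space_form_metric_commute field_simps)
qed (use G_nondegenerate[OF x] tangent[OF x] in auto)

text \<open>\<open>\<Phi>\<close> maps coefficients along \<open>n\<close>, the conormal and the
  surface to a vector. It is an injective linear endomorphism of a 4-dimensional space, hence onto.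
  The constraint reads off the conormal coefficient, which vanishes for tangent \<open>Y\<close>,
  and the metric then reads off the normal one.\<close>

lemma tangent_decomposition:
  assumes x: "x \<in> \<Omega>" and Y: "Y \<in> warped_tangent \<kappa> (\<psi> x)"
  obtains v where "Y = d\<psi> v x + G x Y (n x) *\<^sub>R n x"
proof -
  define \<Phi> :: "ambient \<Rightarrow> ambient"
    where "\<Phi> c = d\<psi> (snd (snd c)) x + fst c *\<^sub>R n x + fst (snd c) *\<^sub>R (0, space_form_conormal \<kappa> (q x))" for c
  have l\<psi>: "linear (frechet_derivative \<psi> (at x))"
    by (rule linear_frechet_derivative[OF smooth_on_differentiable[OF smooth_\<psi> x]])
  have lin: "linear \<Phi>"
    by (rule linearI) (simp_all add: \<Phi>_def linear_add[OF l\<psi>] linear_scale[OF l\<psi>] algebra_simps)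
  have e: "C (q x) (snd (\<Phi> c)) = fst (snd c)" for c
    by (simp add: \<Phi>_def space_form_constraint_simps constraint_jets[OF x] n_eq d\<psi>_eq
        space_form_constraint_conormal[OF \<kappa>])
  have N: "G x (\<Phi> c) (n x) = fst c" if "fst (snd c) = 0" for c
  proof -
    have "\<Phi> c = d\<psi> (snd (snd c)) x + fst c *\<^sub>R n x" using that by (simp add: \<Phi>_def flip: zero_prod_def)
    then show ?thesis
      using n_unit[OF x] n_orthogonal[OF x] by (simp add: G_simps G_commute[of x "d\<psi> _ x"])
  qed
  have "inj \<Phi>"
    unfolding linear_injective_0[OF lin]
  proof (intro allI impI)
    fix c assume c: "\<Phi> c = 0"
    have 1: "fst (snd c) = 0" using e[of c] c by (simp add: space_form_constraint_simps)
    have 2: "fst c = 0" using N[OF 1] c by (simp add: warped_metric_eq space_form_metric_simps)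
    have "d\<psi> (snd (snd c)) x = 0" using c 1 2 by (simp add: \<Phi>_def flip: zero_prod_def)
    then have "snd (snd c) = 0"
      using inj_\<psi>[OF x] linear_injective_0[OF l\<psi>] by blast
    then show "c = 0" using 1 2 by (simp add: prod_eq_iff)
  qed
  then have "surj \<Phi>" by (rule linear_injective_imp_surjective[OF lin _ refl])
  then obtain c where c: "Y = \<Phi> c" by blast
  have 0: "fst (snd c) = 0" using e[of c] Y c by (simp add: warped_tangent_iff)
  have "Y = d\<psi> (snd (snd c)) x + G x Y (n x) *\<^sub>R n x"
    unfolding c N[OF 0] using 0 by (simp add: \<Phi>_def flip: zero_prod_def)
  then show thesis by (rule that)
qed

section \<open>The fundamental forms and the Gauss formula\<close>

abbreviation "I \<equiv> first_ff \<kappa> f \<psi>"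
abbreviation "II \<equiv> second_ff \<kappa> f \<psi> n"

lemma I_eq_G: "I x u v = G x (d\<psi> u x) (d\<psi> v x)"
  by (simp add: first_ff_def)

lemma I_eq: "I x u v = t1 u x * t1 v x + w x * B (q1 u x) (q1 v x)"
  by (simp add: I_eq_G warped_metric_eq d\<psi>_eq)

lemma I_commute: "I x u v = I x v u"
  by (simp add: I_eq_G G_commute)

lemma I_linear:
  assumes x: "x \<in> \<Omega>"
  shows "I x (r *\<^sub>R u + s *\<^sub>R v) v' = r * I x u v' + s * I x v v'"
  by (simp add: I_eq linear_jets[OF x] space_form_metric_simps algebra_simps)

lemma d\<psi>_nonzero:
  assumes "x \<in> \<Omega>" "u \<noteq> 0" shows "d\<psi> u x \<noteq> 0"
  using inj_\<psi>[OF assms(1)] assms(2)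
    linear_injective_0[OF linear_frechet_derivative[OF smooth_on_differentiable[OF smooth_\<psi> assms(1)]]]
  by blast

lemma I_pos: "x \<in> \<Omega> \<Longrightarrow> u \<noteq> 0 \<Longrightarrow> I x u u > 0"
  unfolding I_eq_G by (intro G_pos tangent d\<psi>_nonzero)

lemma d\<psi>_minus: "x \<in> \<Omega> \<Longrightarrow> d\<psi> (- u) x = - d\<psi> u x"
  by (intro linear_neg linear_frechet_derivative[OF smooth_on_differentiable[OF smooth_\<psi>]])

lemma shape_op:
  assumes x: "x \<in> \<Omega>"
  shows "nabla_n u x = - d\<psi> (shape_op \<kappa> f \<psi> n x u) x"
proof -
  obtain v where "nabla_n u x = d\<psi> v x"
    using tangent_decomposition[OF x tangent(2)[OF x]] unfolding G_nabla_n_n[OF x] by auto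
  then have v: "nabla_n u x = - d\<psi> (- v) x" by (simp add: d\<psi>_minus[OF x])
  have "shape_op \<kappa> f \<psi> n x u = - v"
    unfolding shape_op_def levi_civita_n[OF x]
    by (rule the_equality) (use v inj_\<psi>[OF x] in \<open>auto dest: injD\<close>)
  then show ?thesis using v by simp
qed

lemma II_eq_G: "x \<in> \<Omega> \<Longrightarrow> II x u v = - G x (nabla_n u x) (d\<psi> v x)"
  by (simp add: second_ff_def I_eq_G shape_op G_simps)

text \<open>Orthogonality makes the two terms with \<open>f' x * t1 u x * t1 v x\<close> cancel.
  What remains involves only first jets, and it is this expression that is differentiated for the
  Codazzi equation.\<close>

lemma II_eq:
  assumes x: "x \<in> \<Omega>"
  shows "II x u v = - (a1 u x * t1 v x + w x * B (p1 u x) (q1 v x) + f' x * a x * w x * B (q1 u x) (q1 v x))"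
proof -
  have "II x u v = - (a1 u x * t1 v x + f' x * a x * t1 u x * t1 v x + w x * B (p1 u x) (q1 v x)
      + f' x * t1 u x * (w x * B (p x) (q1 v x)) + f' x * a x * w x * B (q1 u x) (q1 v x))"
    unfolding II_eq_G[OF x] warped_metric_eq d\<psi>_eq nabla_n_def
    by (simp add: space_form_metric_simps space_form_metric_conormal[OF \<kappa>] constraint_jets[OF x] algebra_simps)
  then show ?thesis unfolding normal_jets[OF x] by (simp add: algebra_simps)
qed

text \<open>This is the derivative of orthogonality, which the last identity of
  \<open>normal_jets\<close> carries.\<close>

lemma G_nabla_\<psi>_n:
  assumes x: "x \<in> \<Omega>"
  shows "G x (nabla_\<psi> u v x) (n x) = II x u v"
proof -
  have "G x (nabla_\<psi> u v x) (n x) = a x * t2 u v x - f' x * a x * w x * B (q1 u x) (q1 v x)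
     + w x * B (p x) (q2 u v x)
     + f' x * (t1 u x * (w x * B (p x) (q1 v x)) + t1 v x * (w x * B (p x) (q1 u x)))"
    unfolding warped_metric_eq nabla_\<psi>_def
    by (simp add: n_eq space_form_metric_simps space_form_metric_conormal[OF \<kappa>] constraint_jets[OF x]
        space_form_metric_commute algebra_simps)
  then show ?thesis unfolding normal_jets[OF x] II_eq[OF x] by (simp add: algebra_simps)
qed

lemma G_nabla_\<psi>_d\<psi>:
  assumes x: "x \<in> \<Omega>"
  shows "G x (nabla_\<psi> u v x) (d\<psi> Y x) = t2 u v x * t1 Y x + w x * B (q2 u v x) (q1 Y x)
    + f' x * w x * (t1 u x * B (q1 v x) (q1 Y x) + t1 v x * B (q1 u x) (q1 Y x) - t1 Y x * B (q1 u x) (q1 v x))"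
  unfolding warped_metric_eq nabla_\<psi>_def d\<psi>_eq
  by (simp add: space_form_metric_simps space_form_metric_conormal[OF \<kappa>] constraint_jets[OF x] algebra_simps)

lemma has_derivative_I_jets:
  assumes x: "x \<in> \<Omega>"
  shows "((\<lambda>x. I x v v') has_derivative
    (\<lambda>u. G x (nabla_\<psi> u v x) (d\<psi> v' x) + G x (nabla_\<psi> u v' x) (d\<psi> v x))) (at x)"
proof -
  note d = has_derivative_jets[OF x] has_derivative_warp[OF x] has_derivative_space_form_metric
  have "((\<lambda>x. I x v v') has_derivative (\<lambda>u. t1 v x * t2 u v' x + t2 u v x * t1 v' x
      + (w x * (B (q2 u v x) (q1 v' x) + B (q1 v x) (q2 u v' x)) + 2 * f' x * t1 u x * w x * B (q1 v x) (q1 v' x)))) (at x)"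
    unfolding I_eq by (intro has_derivative_add has_derivative_mult d)
  then show ?thesis
    by (rule has_derivative_eq_rhs)
      (simp add: fun_eq_iff G_nabla_\<psi>_d\<psi>[OF x] space_form_metric_commute algebra_simps)
qed

lemma nabla_\<psi>_symmetric: "x \<in> \<Omega> \<Longrightarrow> nabla_\<psi> u v x = nabla_\<psi> v u x"
  by (simp add: nabla_\<psi>_def jets_symmetric[of x u v] space_form_metric_commute[of \<kappa> "q1 u x"]
      space_form_constraint_commute[of \<kappa> "q1 u x"] add.commute)

text \<open>The tangential part \<open>c\<close> of \<open>nabla_\<psi>\<close> satisfies the Koszul
  formula of \<open>I\<close>: the three derivatives of \<open>I\<close> split into six pairings, of
  which symmetry of \<open>nabla_\<psi>\<close> cancels four and identifies the other two.\<close>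

theorem gauss_formula:
  assumes x: "x \<in> \<Omega>"
  shows "nabla_\<psi> u v x = d\<psi> (conn I x u v) x + II x u v *\<^sub>R n x"
proof -
  obtain c where c: "nabla_\<psi> u v x = d\<psi> c x + II x u v *\<^sub>R n x"
    using tangent_decomposition[OF x tangent(3)[OF x]] unfolding G_nabla_\<psi>_n[OF x] by blast
  have Ic: "I x c Y = G x (nabla_\<psi> u v x) (d\<psi> Y x)" for Y
    unfolding c by (simp add: G_simps I_eq_G n_orthogonal[OF x])
  have dI: "frechet_derivative (\<lambda>x. I x v v') (at x) u
      = G x (nabla_\<psi> u v x) (d\<psi> v' x) + G x (nabla_\<psi> u v' x) (d\<psi> v x)" for u v v'
    by (simp add: frechet_derivative_at[OF has_derivative_I_jets[OF x], symmetric])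
  have "conn I x u v = c"
    unfolding conn_def
  proof (rule levi_civita_eqI[where T = "\<lambda>_. UNIV"], rule UNIV_I)
    show "I x c Y = I x (frechet_derivative (\<lambda>_. v) (at x) u) Y
        + (frechet_derivative (\<lambda>q. I q v Y) (at x) (frechet_derivative (\<lambda>y. y) (at x) u)
        + frechet_derivative (\<lambda>q. I q (frechet_derivative (\<lambda>y. y) (at x) u) Y) (at x) v
        - frechet_derivative (\<lambda>q. I q (frechet_derivative (\<lambda>y. y) (at x) u) v) (at x) Y) / 2" for Y
      \<comment> \<open>With all arguments zero this reads \<open>I x 0 v' = 0\<close>; it removes
        the flat derivative of the constant field \<open>v\<close>.\<close>
      using I_linear[OF x, of 0 0 0 0]
      by (simp add: dI Ic nabla_\<psi>_symmetric[OF x, of _ Y] nabla_\<psi>_symmetric[OF x, of v u])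
    fix c' assume *: "\<And>Y. Y \<in> UNIV \<Longrightarrow> I x c' Y = I x c Y"
    show "c' = c"
    proof (rule ccontr)
      assume "c' \<noteq> c"
      then have "I x (c' - c) (c' - c) > 0" by (intro I_pos[OF x]) auto
      moreover have "I x (c' - c) (c' - c) = 0"
        using I_linear[OF x, of 1 c' "-1" c "c' - c"] *[of "c' - c"] by simp
      ultimately show False by simp
    qed
  qed
  then show ?thesis using c by simp
qed

lemma II_commute:
  assumes x: "x \<in> \<Omega>"
  shows "II x u v = II x v u"
  using nabla_\<psi>_symmetric[OF x, of u v] unfolding G_nabla_\<psi>_n[OF x, symmetric] by (rule arg_cong)

lemma conn_symmetric:
  assumes x: "x \<in> \<Omega>"
  shows "conn I x u v = conn I x v u"
proof -
  have "d\<psi> (conn I x u v) x + II x u v *\<^sub>R n x = d\<psi> (conn I x v u) x + II x u v *\<^sub>R n x"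
    using gauss_formula[OF x, of u v] gauss_formula[OF x, of v u]
    unfolding nabla_\<psi>_symmetric[OF x, of u v] II_commute[OF x, of u v] by (rule trans[OF sym])
  then show ?thesis using inj_\<psi>[OF x] by (simp add: inj_eq)
qed

theorem metric_compatible:
  assumes x: "x \<in> \<Omega>"
  shows "((\<lambda>x. I x v v') has_derivative (\<lambda>u. I x (conn I x u v) v' + I x v (conn I x u v'))) (at x)"
  using has_derivative_I_jets[OF x, of v v']
  by (simp add: gauss_formula[OF x] G_simps n_orthogonal[OF x] I_eq_G G_commute[of x "d\<psi> v x"])

section \<open>Derivatives of the height and angle functions\<close>

theorem has_derivative_height_jets:
  assumes x: "x \<in> \<Omega>"
  shows "(t1 v has_derivative
    (\<lambda>u. t1 (conn I x u v) x + f' x * (I x u v - t1 u x * t1 v x) + II x u v * a x)) (at x)"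
proof (rule has_derivative_eq_rhs[OF has_derivative_jets(3)[OF x]], rule ext)
  fix u
  \<comment> \<open>The first component of the Gauss formula; in it
    \<open>w x * B (q1 u x) (q1 v x)\<close> is \<open>I x u v\<close> minus the product of the
    height derivatives.\<close>
  have "t2 u v x - f' x * (w x * B (q1 u x) (q1 v x)) = t1 (conn I x u v) x + II x u v * a x"
    using arg_cong[OF gauss_formula[OF x, of u v], of fst] by (simp add: nabla_\<psi>_def d\<psi>_eq n_eq mult.assoc)
  then show "t2 u v x = t1 (conn I x u v) x + f' x * (I x u v - t1 u x * t1 v x) + II x u v * a x"
    unfolding I_eq by (simp add: algebra_simps)
qed

text \<open>\<open>T\<close> is the tangential part of (1, 0), and pairing with (1, 0) reads off the
  first component of a vector. Applied to \<open>d\<psi> v x\<close> this gives dh, applied to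
  \<open>nabla_n u x\<close> it gives d\<nu>.\<close>

theorem height_gradient:
  assumes x: "x \<in> \<Omega>"
  obtains T where "\<And>v. I x T v = t1 v x" "t1 T x = 1 - a x * a x"
    "\<And>u. a1 u x = - II x u T - f' x * a x * t1 u x"
proof -
  have "G x (1, 0) (n x) = a x" by (simp add: warped_metric_eq n_eq space_form_metric_simps)
  with tangent_decomposition[OF x tangent(4)[OF x]]
  obtain T where T: "(1, 0) = d\<psi> T x + a x *\<^sub>R n x" by metis
  have fst_eq: "fst Y = G x Y (d\<psi> T x) + a x * G x Y (n x)" for Y
  proof -
    have "fst Y = G x Y (1, 0)" by (simp add: warped_metric_eq space_form_metric_simps)
    then show ?thesis unfolding T by (simp add: G_simps)
  qed
  have 1: "I x T v = t1 v x" for v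
    using fst_eq[of "d\<psi> v x"]
    by (simp add: I_eq_G G_commute[of x "d\<psi> v x"] n_orthogonal[OF x] t1_def)
  have 2: "t1 T x = 1 - a x * a x"
    using arg_cong[OF T, of fst] by (simp add: d\<psi>_eq n_eq)
  have 3: "a1 u x = - II x u T - f' x * a x * t1 u x" for u
  proof -
    have "fst (nabla_n u x) = a1 u x + f' x * a x * t1 u x" by (simp add: nabla_n_def)
    then show ?thesis using fst_eq[of "nabla_n u x"] by (simp add: G_nabla_n_n[OF x] II_eq_G[OF x])
  qed
  show thesis by (rule that[OF 1 2 3])
qed

section \<open>The Codazzi equation\<close>

lemma II_conn:
  assumes x: "x \<in> \<Omega>"
  shows "II x v (conn I x u v') = - (G x (nabla_n v x) (nabla_\<psi> u v' x))"
  unfolding II_eq_G[OF x] gauss_formula[OF x] by (simp add: G_simps G_nabla_n_n[OF x])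

text \<open>If \<kappa> is 1 or -1, then \<open>C\<close> is \<kappa> times \<open>B\<close> and the
  two factors cancel; if \<kappa> = 0, both sides vanish.\<close>

lemma kappa_constraint_mult:
  "\<kappa> * (C u v * C u' v') = \<kappa> * (B u v * B u' v')"
  using \<kappa> by (auto simp: space_form_constraint_def space_form_metric_def algebra_simps)

text \<open>The last term is where \<kappa> enters. The conormal parts paired with \<open>p1\<close>
  and \<open>q2\<close> contribute -1 each and paired with each other +1, so one negative copy
  survives. The factor \<open>w x\<close> completes both \<open>B\<close> factors of that
  term.\<close>

lemma G_nabla_n_nabla_\<psi>:
  assumes x: "x \<in> \<Omega>"
  shows "w x * G x (nabla_n v x) (nabla_\<psi> u v' x) =
    w x * ((a1 v x + f' x * a x * t1 v x) * (t2 u v' x - f' x * w x * B (q1 u x) (q1 v' x))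
     + w x * B (p1 v x) (q2 u v' x) + f' x * w x * (t1 u x * B (p1 v x) (q1 v' x) + t1 v' x * B (p1 v x) (q1 u x))
     + f' x * t1 v x * (w x * B (p x) (q2 u v' x) + f' x * (t1 u x * (w x * B (p x) (q1 v' x)) + t1 v' x * (w x * B (p x) (q1 u x))))
     + f' x * a x * w x * (B (q1 v x) (q2 u v' x) + f' x * (t1 u x * B (q1 v x) (q1 v' x) + t1 v' x * B (q1 v x) (q1 u x))))
     - \<kappa> * ((w x * B (p x) (q1 v x)) * (w x * B (q1 u x) (q1 v' x)))"
proof -
  have "G x (nabla_n v x) (nabla_\<psi> u v' x) =
    ((a1 v x + f' x * a x * t1 v x) * (t2 u v' x - f' x * w x * B (q1 u x) (q1 v' x))
     + w x * B (p1 v x) (q2 u v' x) + f' x * w x * (t1 u x * B (p1 v x) (q1 v' x) + t1 v' x * B (p1 v x) (q1 u x))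
     + f' x * t1 v x * (w x * B (p x) (q2 u v' x) + f' x * (t1 u x * (w x * B (p x) (q1 v' x)) + t1 v' x * (w x * B (p x) (q1 u x))))
     + f' x * a x * w x * (B (q1 v x) (q2 u v' x) + f' x * (t1 u x * B (q1 v x) (q1 v' x) + t1 v' x * B (q1 v x) (q1 u x))))
     - w x * (\<kappa> * (C (q1 v x) (p x) * C (q1 u x) (q1 v' x)))"
    unfolding warped_metric_eq nabla_n_def nabla_\<psi>_def
    by (simp add: space_form_metric_simps space_form_metric_conormal[OF \<kappa>] constraint_jets[OF x]
        space_form_constraint_conormal[OF \<kappa>] algebra_simps)
  then show ?thesis
    unfolding kappa_constraint_mult space_form_metric_commute[of \<kappa> "q1 v x" "p x"]
    by (simp only: right_diff_distrib) (simp add: algebra_simps)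
qed

lemma has_derivative_II_jets:
  assumes x: "x \<in> \<Omega>"
  shows "((\<lambda>x. II x v v') has_derivative (\<lambda>u. - (a2 u v x * t1 v' x + a1 v x * t2 u v' x
      + w x * (B (p2 u v x) (q1 v' x) + B (p1 v x) (q2 u v' x)) + 2 * f' x * t1 u x * w x * B (p1 v x) (q1 v' x)
      + f' x * a x * w x * (B (q2 u v x) (q1 v' x) + B (q1 v x) (q2 u v' x))
      + (f'' x * t1 u x * a x + f' x * a1 u x + 2 * f' x * f' x * t1 u x * a x) * (w x * B (q1 v x) (q1 v' x))))) (at x)"
proof -
  note d = has_derivative_jets[OF x] has_derivative_warp[OF x] has_derivative_space_form_metric
  have "((\<lambda>x. - (a1 v x * t1 v' x + w x * B (p1 v x) (q1 v' x) + f' x * a x * w x * B (q1 v x) (q1 v' x)))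
    has_derivative (\<lambda>u. - (a1 v x * t2 u v' x + a2 u v x * t1 v' x
      + (w x * (B (p2 u v x) (q1 v' x) + B (p1 v x) (q2 u v' x)) + 2 * f' x * t1 u x * w x * B (p1 v x) (q1 v' x))
      + (f' x * a x * w x * (B (q2 u v x) (q1 v' x) + B (q1 v x) (q2 u v' x))
        + (f' x * a x * (2 * f' x * t1 u x * w x) + (f' x * a1 u x + f'' x * t1 u x * a x) * w x)
          * B (q1 v x) (q1 v' x))))) (at x)"
    by (intro has_derivative_minus has_derivative_add has_derivative_mult d)
  from has_derivative_transform_within_open[OF this open_\<Omega> x II_eq[symmetric]] show ?thesis
    by (rule has_derivative_eq_rhs) (simp_all add: fun_eq_iff algebra_simps)
qed

text \<open>Since \<open>conn\<close> is torsion-free, the terms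
  \<open>II x (conn I x u v) v'\<close> of the two covariant derivatives have already cancelled in
  this form of the left side.\<close>

theorem codazzi:
  assumes x: "x \<in> \<Omega>"
  shows "frechet_derivative (\<lambda>x. II x v v') (at x) u - frechet_derivative (\<lambda>x. II x u v') (at x) v
      - II x v (conn I x u v') + II x u (conn I x v v')
    = - (f'' x + \<kappa> * exp (- 2 * f (fst (\<psi> x)))) * a x * (I x v v' * t1 u x - I x u v' * t1 v x)"
proof -
  have w: "exp (- 2 * f (fst (\<psi> x))) = 1 / w x" by (simp add: w_def exp_minus field_simps)
  have sym: "a1 v x * t1 u x + w x * B (p1 v x) (q1 u x) = a1 u x * t1 v x + w x * B (p1 u x) (q1 v x)"
    using II_commute[OF x, of u v] unfolding II_eq[OF x] space_form_metric_commute[of \<kappa> "q1 v x" "q1 u x"]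
    by linarith
  have wG: "w x * (frechet_derivative (\<lambda>x. II x v v') (at x) u - frechet_derivative (\<lambda>x. II x u v') (at x) v
      + G x (nabla_n v x) (nabla_\<psi> u v' x) - G x (nabla_n u x) (nabla_\<psi> v v' x))
    = - (f'' x * w x + \<kappa>) * a x * (I x v v' * t1 u x - I x u v' * t1 v x)"
    unfolding frechet_derivative_at[OF has_derivative_II_jets[OF x], symmetric] I_eq
      right_diff_distrib distrib_left[of "w x"] G_nabla_n_nabla_\<psi>[OF x] normal_jets[OF x]
    \<comment> \<open>The terms with factor \<open>f' x * t1 v' x\<close> pair \<open>p1\<close> in
      one direction with \<open>q1\<close> in the other; this multiple of the symmetry of
      \<open>II\<close> cancels them.\<close>
    using arg_cong[OF sym, of "\<lambda>r. f' x * t1 v' x * w x * r"]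
    by (simp add: jets_symmetric[OF x] space_form_metric_commute algebra_simps)
  have "- (f'' x * w x + \<kappa>) * a x * (I x v v' * t1 u x - I x u v' * t1 v x)
     = w x * (- (f'' x + \<kappa> * (1 / w x)) * a x * (I x v v' * t1 u x - I x u v' * t1 v x))"
    using w_pos[of x] by (simp add: field_simps)
  then have "frechet_derivative (\<lambda>x. II x v v') (at x) u - frechet_derivative (\<lambda>x. II x u v') (at x) v
      + G x (nabla_n v x) (nabla_\<psi> u v' x) - G x (nabla_n u x) (nabla_\<psi> v v' x)
     = - (f'' x + \<kappa> * (1 / w x)) * a x * (I x v v' * t1 u x - I x u v' * t1 v x)"
    using trans[OF wG] w_pos[of x] by (metis mult_left_cancel less_irrefl)
  then show ?thesis unfolding II_conn[OF x] w by simp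
qed

end

section \<open>Wirtinger derivatives\<close>

lemma Dz_has_derivative:
  assumes "(F has_derivative F') (at x)"
  shows "Dz F x = (F' 1 - \<i> * F' \<i>) / 2" "Dzb F x = (F' 1 + \<i> * F' \<i>) / 2"
  unfolding Dz_def Dzb_def frechet_derivative_at[OF assms, symmetric]
  by (simp_all add: ext1_def d_z_def d_zb_def field_simps)

text \<open>\<open>frechet_derivative\<close> is chosen through \<open>has_derivative\<close>, which
  holds for the same maps when two functions agree near \<open>x\<close>. This permits replacing
  \<open>Dz h\<close> by \<open>hz\<close> under a further derivative.\<close>

lemma Dz_cong:
  assumes "open S" "x \<in> S" "\<And>y. y \<in> S \<Longrightarrow> F y = G y"
  shows "Dz F x = Dz G x" "Dzb F x = Dzb G x"
proof -
  have "(F has_derivative L) (at x) \<longleftrightarrow> (G has_derivative L) (at x)" for L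
    using has_derivative_transform_within_open[of F L x UNIV S G] has_derivative_transform_within_open[of G L x UNIV S F] assms
    by auto
  then show "Dz F x = Dz G x" "Dzb F x = Dzb G x"
    by (simp_all add: Dz_def Dzb_def frechet_derivative_def)
qed

text \<open>The differential written as F_z dz + F_zb dzb, where dz and dzb take the values
  \<open>u\<close> and \<open>cnj u\<close>. Carrying both coefficients makes conjugation a
  swap.\<close>

definition has_wirtinger :: "(complex \<Rightarrow> complex) \<Rightarrow> complex \<Rightarrow> complex \<Rightarrow> complex \<Rightarrow> bool" where
  "has_wirtinger F A B x \<longleftrightarrow> (F has_derivative (\<lambda>u. A * u + B * cnj u)) (at x)"

lemma has_wirtinger_Dz:
  assumes "has_wirtinger F A B x"
  shows "Dz F x = A" "Dzb F x = B"
  using Dz_has_derivative[OF assms[unfolded has_wirtinger_def]] by (simp_all add: field_simps)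

lemma has_wirtinger_of_has_derivative:
  assumes "(F has_derivative F') (at x)"
    and "A = (F' 1 - \<i> * F' \<i>) / 2" "B = (F' 1 + \<i> * F' \<i>) / 2"
  shows "has_wirtinger F A B x"
  unfolding has_wirtinger_def assms(2,3)
proof (rule has_derivative_eq_rhs[OF assms(1)], rule ext)
  fix u
  have l: "linear F'" using assms(1) has_derivative_linear by blast
  have "u = Re u *\<^sub>R 1 + Im u *\<^sub>R \<i>" by (simp add: complex_eq_iff)
  then have "F' u = Re u *\<^sub>R F' 1 + Im u *\<^sub>R F' \<i>"
    by (metis linear_add[OF l] linear_scale[OF l])
  then show "F' u = (F' 1 - \<i> * F' \<i>) / 2 * u + (F' 1 + \<i> * F' \<i>) / 2 * cnj u"
    by (simp add: complex_eq_iff field_simps)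
qed

lemma has_wirtinger_eq_rhs:
  "has_wirtinger F A B x \<Longrightarrow> A = A' \<Longrightarrow> B = B' \<Longrightarrow> has_wirtinger F A' B' x"
  by simp

lemma has_wirtinger_cong:
  assumes "has_wirtinger F A B x" "open S" "x \<in> S" "\<And>y. y \<in> S \<Longrightarrow> F y = G y"
  shows "has_wirtinger G A B x"
  using assms has_derivative_transform_within_open unfolding has_wirtinger_def by blast

lemma has_wirtinger_minus:
  "has_wirtinger F A B x \<Longrightarrow> has_wirtinger (\<lambda>x. - F x) (- A) (- B) x"
  unfolding has_wirtinger_def
  by (drule has_derivative_minus, erule has_derivative_eq_rhs) (simp add: fun_eq_iff algebra_simps)

lemma has_wirtinger_diff:
  "has_wirtinger F A B x \<Longrightarrow> has_wirtinger G A' B' x \<Longrightarrow> has_wirtinger (\<lambda>x. F x - G x) (A - A') (B - B') x"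
  unfolding has_wirtinger_def
  by (drule (1) has_derivative_diff, erule has_derivative_eq_rhs) (simp add: fun_eq_iff algebra_simps)

lemma has_wirtinger_mult:
  "has_wirtinger F A B x \<Longrightarrow> has_wirtinger G A' B' x \<Longrightarrow>
    has_wirtinger (\<lambda>x. F x * G x) (F x * A' + A * G x) (F x * B' + B * G x) x"
  unfolding has_wirtinger_def
  by (drule (1) has_derivative_mult, erule has_derivative_eq_rhs) (simp add: fun_eq_iff algebra_simps)

lemma has_wirtinger_divide:
  "has_wirtinger F A B x \<Longrightarrow> has_wirtinger G A' B' x \<Longrightarrow> G x \<noteq> 0 \<Longrightarrow>
    has_wirtinger (\<lambda>x. F x / G x) ((A * G x - F x * A') / (G x * G x)) ((B * G x - F x * B') / (G x * G x)) x"
  unfolding has_wirtinger_def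
  by (drule (2) has_derivative_divide', erule has_derivative_eq_rhs) (simp add: fun_eq_iff field_simps)

lemma has_wirtinger_cnj:
  "has_wirtinger F A B x \<Longrightarrow> has_wirtinger (\<lambda>x. cnj (F x)) (cnj B) (cnj A) x"
  unfolding has_wirtinger_def
  by (drule has_derivative_cnj, erule has_derivative_eq_rhs) (simp add: fun_eq_iff algebra_simps)

lemma ext2_d:
  "ext2 T d_z d_z = (T 1 1 - T \<i> \<i> - \<i> * (T 1 \<i> + T \<i> 1)) / 4"
  "ext2 T d_z d_zb = (T 1 1 + T \<i> \<i> + \<i> * (T 1 \<i> - T \<i> 1)) / 4"
  "ext2 T d_zb d_zb = (T 1 1 - T \<i> \<i> + \<i> * (T 1 \<i> + T \<i> 1)) / 4"
  by (simp_all add: ext2_def ext1_def d_z_def d_zb_def field_simps)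

section \<open>Parameters conformal for the second fundamental form\<close>

locale conformal_patch = oriented_patch +
  assumes conformal: "x \<in> \<Omega> \<Longrightarrow> \<exists>r>0. \<forall>u v. II x u v = 2 * r * (u \<bullet> v)"
begin

definition "E x = ext2 (\<lambda>u v. complex_of_real (I x u v)) d_z d_z"
definition "F x = ext2 (\<lambda>u v. complex_of_real (I x u v)) d_z d_zb"
definition "\<rho> x = ext2 (\<lambda>u v. complex_of_real (II x u v)) d_z d_zb"
definition "h x = complex_of_real (height \<psi> x)"
definition "\<nu> x = complex_of_real (angle \<kappa> f \<psi> n x)"
definition "K x = complex_of_real (extrinsic_curvature \<kappa> f \<psi> n x)"
definition "f1 x = complex_of_real (deriv f (height \<psi> x))"
definition "f2 x = complex_of_real (deriv (deriv f) (height \<psi> x))"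
definition "c x = f2 x + complex_of_real (\<kappa> * exp (- 2 * f (height \<psi> x)))"
definition "D x = complex_of_real ((cmod (E x))\<^sup>2) - (F x)\<^sup>2"
definition "\<alpha> x = cnj (E x) * Dz h x - F x * Dzb h x"
text \<open>This is h_z expressed by the first jet, in the form that
  \<open>has_derivative_height_jets\<close> can differentiate.\<close>

definition "hz x = (complex_of_real (t1 1 x) - \<i> * complex_of_real (t1 \<i> x)) / 2"
abbreviation "\<Gamma>111 x \<equiv> Gamma1 I d_z d_z x"
abbreviation "\<Gamma>211 x \<equiv> Gamma2 I d_z d_z x"
abbreviation "\<Gamma>112 x \<equiv> Gamma1 I d_z d_zb x"
abbreviation "\<Gamma>222 x \<equiv> Gamma2 I d_zb d_zb x"

lemma \<nu>_eq: "\<nu> x = complex_of_real (a x)"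
  by (simp add: \<nu>_def angle_def warped_metric_def space_form_metric_simps a_def)

lemma f1_eq: "f1 x = complex_of_real (f' x)" and f2_eq: "f2 x = complex_of_real (f'' x)"
  by (simp_all add: f1_def f2_def f'_def f''_def height_def)

lemma c_eq: "c x = complex_of_real (f'' x + \<kappa> * exp (- 2 * f (fst (\<psi> x))))"
  by (simp add: c_def f2_eq height_def)

lemma E_eq: "E x = (of_real (I x 1 1) - of_real (I x \<i> \<i>) - 2 * \<i> * of_real (I x 1 \<i>)) / 4"
  by (simp add: E_def ext2_d I_commute[of x \<i> 1])

lemma F_eq: "F x = (of_real (I x 1 1) + of_real (I x \<i> \<i>)) / 4"
  by (simp add: F_def ext2_d I_commute[of x \<i> 1])

lemma cnj_F [simp]: "cnj (F x) = F x" by (simp add: F_eq)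

lemma cnj_real [simp]:
  "cnj (\<nu> x) = \<nu> x" "cnj (f1 x) = f1 x" "cnj (f2 x) = f2 x" "cnj (c x) = c x" "cnj (K x) = K x"
  by (simp_all add: \<nu>_eq f1_eq f2_eq c_eq K_def)

lemma D_eq: "D x = E x * cnj (E x) - F x * F x"
  by (simp add: D_def complex_norm_square power2_eq_square[of "F x"] del: of_real_power)

lemma cnj_D [simp]: "cnj (D x) = D x"
  by (simp add: D_eq mult.commute)

text \<open>The frame coefficients of a real vector \<open>u\<close> are \<open>u\<close> and
  \<open>cnj u\<close>. The identity translates the real values of \<open>I\<close> produced by
  metric compatibility into \<open>E\<close> and \<open>F\<close>.\<close>

lemma I_E_F:
  assumes x: "x \<in> \<Omega>"
  shows "complex_of_real (I x u v) =
    E x * u * v + F x * (u * cnj v + cnj u * v) + cnj (E x) * cnj u * cnj v"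
proof -
  have dec: "z = Re z *\<^sub>R 1 + Im z *\<^sub>R \<i>" for z by (simp add: complex_eq_iff)
  have "I x u v = Re u * (Re v * I x 1 1 + Im v * I x 1 \<i>) + Im u * (Re v * I x 1 \<i> + Im v * I x \<i> \<i>)"
    by (subst dec[of u], subst I_linear[OF x], subst (1 2) I_commute, subst (1 2) dec[of v])
      (simp only: I_linear[OF x] I_commute[of x \<i> 1])
  then show ?thesis
    by (simp add: E_eq F_eq complex_eq_iff field_simps)
qed

lemma t1_hz:
  assumes x: "x \<in> \<Omega>"
  shows "complex_of_real (t1 u x) = hz x * u + cnj (hz x) * cnj u"
proof -
  have "t1 u x = Re u * t1 1 x + Im u * t1 \<i> x"
    using linear_jets(1)[OF x, of "Re u" 1 "Im u" \<i>] by (simp add: complex_eq[symmetric] scaleR_conv_of_real mult.commute)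
  then show ?thesis by (simp add: hz_def complex_eq_iff field_simps)
qed

text \<open>The conformal factor is given only pointwise, by an existential; it is identified with
  \<open>II x 1 1 / 2\<close>, which is differentiable in \<open>x\<close>.\<close>

lemma \<rho>_conformal:
  assumes x: "x \<in> \<Omega>"
  shows "\<rho> x = of_real (II x 1 1 / 2)" "II x u v = II x 1 1 * (u \<bullet> v)" "II x 1 1 > 0"
  using conformal[OF x] by (auto simp: \<rho>_def ext2_d inner_complex_def)

lemma II_\<rho>:
  assumes x: "x \<in> \<Omega>"
  shows "complex_of_real (II x u v) = \<rho> x * (u * cnj v + cnj u * v)"
  unfolding \<rho>_conformal(1)[OF x] \<rho>_conformal(2)[OF x, of u v]
  by (simp add: complex_eq_iff inner_complex_def algebra_simps)

lemma \<rho>_nonzero: "x \<in> \<Omega> \<Longrightarrow> \<rho> x \<noteq> 0"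
  using \<rho>_conformal(1,3) by force

lemma cnj_\<rho>: "x \<in> \<Omega> \<Longrightarrow> cnj (\<rho> x) = \<rho> x"
  by (simp only: \<rho>_conformal(1) complex_cnj_complex_of_real)

lemma \<Gamma>_eq:
  assumes x: "x \<in> \<Omega>"
  shows "\<Gamma>111 x = (conn I x 1 1 - conn I x \<i> \<i> - 2 * \<i> * conn I x 1 \<i>) / 4"
    "\<Gamma>211 x = (cnj (conn I x 1 1) - cnj (conn I x \<i> \<i>) - 2 * \<i> * cnj (conn I x 1 \<i>)) / 4"
    "\<Gamma>112 x = (conn I x 1 1 + conn I x \<i> \<i>) / 4"
    "\<Gamma>222 x = cnj (\<Gamma>111 x)"
  by (simp_all add: Gamma1_def Gamma2_def ext2_d conn_symmetric[OF x, of \<i> 1])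

section \<open>First derivatives of the metric coefficients and of h_z\<close>

lemma has_wirtinger_E:
  assumes x: "x \<in> \<Omega>"
  shows "has_wirtinger E (2 * (\<Gamma>111 x * E x + \<Gamma>211 x * F x))
    (2 * (\<Gamma>112 x * E x + cnj (\<Gamma>112 x) * F x)) x"
proof -
  have "(E has_derivative (\<lambda>u. (of_real (I x (conn I x u 1) 1 + I x 1 (conn I x u 1))
      - of_real (I x (conn I x u \<i>) \<i> + I x \<i> (conn I x u \<i>))
      - 2 * \<i> * of_real (I x (conn I x u 1) \<i> + I x 1 (conn I x u \<i>))) / 4)) (at x)"
    unfolding E_eq[abs_def]
    by (intro has_derivative_divide' has_derivative_diff has_derivative_mult_right has_derivative_of_real
        metric_compatible[OF x] bounded_linear.has_derivative[OF bounded_linear_divide])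
  then show ?thesis
    by (rule has_wirtinger_of_has_derivative)
      (simp_all add: I_E_F[OF x] \<Gamma>_eq[OF x] conn_symmetric[OF x, of \<i> 1] field_simps)
qed

lemma has_wirtinger_F:
  assumes x: "x \<in> \<Omega>"
  shows "has_wirtinger F
    (\<Gamma>111 x * F x + \<Gamma>211 x * cnj (E x) + \<Gamma>112 x * E x + cnj (\<Gamma>112 x) * F x)
    (cnj (\<Gamma>111 x * F x + \<Gamma>211 x * cnj (E x) + \<Gamma>112 x * E x + cnj (\<Gamma>112 x) * F x)) x"
proof -
  have "(F has_derivative (\<lambda>u. (of_real (I x (conn I x u 1) 1 + I x 1 (conn I x u 1))
      + of_real (I x (conn I x u \<i>) \<i> + I x \<i> (conn I x u \<i>))) / 4)) (at x)"
    unfolding F_eq[abs_def]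
    by (intro has_derivative_add has_derivative_of_real
        metric_compatible[OF x] bounded_linear.has_derivative[OF bounded_linear_divide])
  then show ?thesis
    by (rule has_wirtinger_of_has_derivative)
      (simp_all add: I_E_F[OF x] \<Gamma>_eq[OF x] conn_symmetric[OF x, of \<i> 1] field_simps)
qed

lemma has_wirtinger_h:
  assumes x: "x \<in> \<Omega>"
  shows "has_wirtinger h (hz x) (cnj (hz x)) x"
  unfolding h_def[abs_def] height_def
  by (rule has_wirtinger_of_has_derivative[OF has_derivative_of_real[OF has_derivative_jets(1)[OF x]]])
    (simp_all add: hz_def)

text \<open>The Hessian of h on the complex frame. Since \<open>II\<close> vanishes on (d_z, d_z),
  the angle function enters only the mixed derivative.\<close>

lemma has_wirtinger_hz:
  assumes x: "x \<in> \<Omega>"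
  shows "has_wirtinger hz
    (\<Gamma>111 x * hz x + \<Gamma>211 x * cnj (hz x) + f1 x * (E x - (hz x)\<^sup>2))
    (\<Gamma>112 x * hz x + cnj (\<Gamma>112 x) * cnj (hz x) + f1 x * (F x - hz x * cnj (hz x)) + \<rho> x * \<nu> x) x"
proof -
  let ?H = "\<lambda>u v. t1 (conn I x u v) x + f' x * (I x u v - t1 u x * t1 v x) + II x u v * a x"
  have "(hz has_derivative (\<lambda>u. (of_real (?H u 1) - \<i> * of_real (?H u \<i>)) / 2)) (at x)"
    unfolding hz_def[abs_def]
    by (intro has_derivative_diff has_derivative_mult_right has_derivative_of_real
        has_derivative_height_jets[OF x] bounded_linear.has_derivative[OF bounded_linear_divide])
  then show ?thesis
    by (rule has_wirtinger_of_has_derivative)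
      (simp_all add: I_E_F[OF x] t1_hz[OF x] II_\<rho>[OF x] f1_eq \<nu>_eq \<Gamma>_eq[OF x] conn_symmetric[OF x, of \<i> 1]
        power2_eq_square field_simps)
qed

lemma has_wirtinger_f1:
  assumes x: "x \<in> \<Omega>"
  shows "has_wirtinger f1 (f2 x * hz x) (f2 x * cnj (hz x)) x"
  unfolding f1_eq[abs_def]
  by (rule has_wirtinger_of_has_derivative[OF has_derivative_of_real[OF has_derivative_warp(2)[OF x]]])
    (simp_all add: hz_def f2_eq field_simps)

lemma Dz_h:
  assumes x: "x \<in> \<Omega>"
  shows "Dz h x = hz x" "Dzb h x = cnj (hz x)"
  using has_wirtinger_Dz[OF has_wirtinger_h[OF x]] by simp_all

lemma \<alpha>_eq: "x \<in> \<Omega> \<Longrightarrow> \<alpha> x = cnj (E x) * hz x - F x * cnj (hz x)"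
  by (simp add: \<alpha>_def Dz_h)

section \<open>Determinants, curvature and the gradient of the height\<close>

lemma det_I:
  assumes x: "x \<in> \<Omega>"
  shows "I x 1 1 * I x \<i> \<i> - (I x 1 \<i>)\<^sup>2 > 0" "D x = - of_real (I x 1 1 * I x \<i> \<i> - (I x 1 \<i>)\<^sup>2) / 4"
proof -
  show "I x 1 1 * I x \<i> \<i> - (I x 1 \<i>)\<^sup>2 > 0"
  proof (rule det_positive_definite)
    fix r s :: real assume "r \<noteq> 0 \<or> s \<noteq> 0"
    then have "Complex r s \<noteq> 0" by (simp add: complex_eq_iff)
    from I_pos[OF x this] have "complex_of_real (I x (Complex r s) (Complex r s)) \<noteq> 0"
      "I x (Complex r s) (Complex r s) > 0" by simp_all
    moreover have "complex_of_real (I x (Complex r s) (Complex r s))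
        = of_real (I x 1 1 * r\<^sup>2 + 2 * I x 1 \<i> * r * s + I x \<i> \<i> * s\<^sup>2)"
      unfolding I_E_F[OF x, of "Complex r s"] E_eq F_eq
      by (simp add: complex_eq_iff power2_eq_square field_simps)
    ultimately show "I x 1 1 * r\<^sup>2 + 2 * I x 1 \<i> * r * s + I x \<i> \<i> * s\<^sup>2 > 0"
      by (metis of_real_eq_iff)
  qed
  show "D x = - of_real (I x 1 1 * I x \<i> \<i> - (I x 1 \<i>)\<^sup>2) / 4"
    unfolding D_eq E_eq F_eq by (simp add: power2_eq_square field_simps)
qed

lemma D_nonzero: "x \<in> \<Omega> \<Longrightarrow> D x \<noteq> 0"
  using det_I by (metis divide_eq_0_iff less_irrefl neg_equal_0_iff_equal of_real_eq_0_iff zero_neq_numeral)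

text \<open>det S det I = det II, where det II = (2 \<rho>)^2 in a conformal parameter and det I =
  -4 D.\<close>

lemma K_eq:
  assumes x: "x \<in> \<Omega>"
  shows "K x = - (\<rho> x * \<rho> x) / D x" "K x \<noteq> 0"
proof -
  let ?S = "shape_op \<kappa> f \<psi> n x"
  let ?r = "II x 1 1"
  have S: "I x (?S u) v = ?r * (u \<bullet> v)" for u v
    using \<rho>_conformal(2)[OF x, of u v] by (simp add: second_ff_def)
  have lin: "I x u v = Re u * I x 1 v + Im u * I x \<i> v" for u v
    using I_linear[OF x, of "Re u" 1 "Im u" \<i> v] by (simp add: scaleR_conv_of_real complex_eq[symmetric] mult.commute)
  have "det_real ?S * (I x 1 1 * I x \<i> \<i> - (I x 1 \<i>)\<^sup>2)
    = I x (?S 1) 1 * I x (?S \<i>) \<i> - I x (?S 1) \<i> * I x (?S \<i>) 1"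
    unfolding det_real_def lin[of "?S 1"] lin[of "?S \<i>"] I_commute[of x \<i> 1]
    by (simp add: power2_eq_square algebra_simps)
  also have "\<dots> = ?r * ?r" unfolding S by simp
  finally have "complex_of_real (det_real ?S * (I x 1 1 * I x \<i> \<i> - (I x 1 \<i>)\<^sup>2)) = of_real ?r * of_real ?r"
    by (simp only: of_real_mult)
  then have KD: "K x * D x = - (\<rho> x * \<rho> x)"
    unfolding K_def extrinsic_curvature_def det_I(2)[OF x] \<rho>_conformal(1)[OF x] of_real_mult
    by (simp add: field_simps)
  then show "K x = - (\<rho> x * \<rho> x) / D x" using D_nonzero[OF x] by (simp add: field_simps)
  show "K x \<noteq> 0" using KD \<rho>_nonzero[OF x] by auto
qed

text \<open>Here \<open>T\<close> is a complex number; solving hz = E T + F \<open>cnj T\<close>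
  together with its conjugate gives \<alpha> = D T. The second identity is dh(T) = 1 - \<nu>^2 with
  the denominator cleared.\<close>

lemma gradient:
  assumes x: "x \<in> \<Omega>"
  shows "has_wirtinger \<nu> (- \<rho> x * cnj (\<alpha> x) / D x - f1 x * \<nu> x * hz x)
      (- \<rho> x * \<alpha> x / D x - f1 x * \<nu> x * cnj (hz x)) x"
    and "hz x * \<alpha> x + cnj (hz x) * cnj (\<alpha> x) = D x * (1 - (\<nu> x)\<^sup>2)"
proof -
  obtain T where T: "\<And>v. I x T v = t1 v x" "t1 T x = 1 - a x * a x"
    "\<And>u. a1 u x = - II x u T - f' x * a x * t1 u x"
    using height_gradient[OF x] by blast
  have hz: "hz x = E x * T + F x * cnj T"
    unfolding hz_def T(1)[symmetric] I_E_F[OF x] by (simp add: field_simps)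
  have "\<alpha> x = D x * T" unfolding \<alpha>_eq[OF x] hz D_eq by (simp add: algebra_simps)
  then have TD: "T = \<alpha> x / D x" "cnj T = cnj (\<alpha> x) / D x" using D_nonzero[OF x] by simp_all
  show "has_wirtinger \<nu> (- \<rho> x * cnj (\<alpha> x) / D x - f1 x * \<nu> x * hz x)
      (- \<rho> x * \<alpha> x / D x - f1 x * \<nu> x * cnj (hz x)) x"
    unfolding \<nu>_eq[abs_def]
    by (rule has_wirtinger_of_has_derivative[OF has_derivative_of_real[OF has_derivative_jets(5)[OF x]]])
      (simp_all add: T(3) II_\<rho>[OF x] t1_hz[OF x] TD f1_eq field_simps)
  have "hz x * T + cnj (hz x) * cnj T = 1 - (\<nu> x)\<^sup>2"
    using arg_cong[OF T(2), of complex_of_real] by (simp add: t1_hz[OF x] \<nu>_eq power2_eq_square)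
  then show "hz x * \<alpha> x + cnj (hz x) * cnj (\<alpha> x) = D x * (1 - (\<nu> x)\<^sup>2)"
    unfolding TD using D_nonzero[OF x] by (simp add: field_simps)
qed

text \<open>\<open>II x 1 \<i>\<close> vanishes identically, so the Codazzi equation for the
  directions 1 and \<open>\<i>\<close>, tested against \<open>\<i>\<close> and 1, isolates the
  derivative of \<open>II x 1 1\<close> along 1 and along \<open>\<i>\<close>. The two real
  equations combine into one complex equation.\<close>

lemma has_wirtinger_\<rho>:
  assumes x: "x \<in> \<Omega>"
  shows "has_wirtinger \<rho> (\<nu> x * cnj (\<alpha> x) * c x - \<rho> x * (cnj (\<Gamma>112 x) - \<Gamma>111 x))
    (\<nu> x * \<alpha> x * c x - \<rho> x * (\<Gamma>112 x - \<Gamma>222 x)) x"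
proof -
  define L where "L = frechet_derivative (\<lambda>x. II x 1 1) (at x)"
  have L: "((\<lambda>x. II x 1 1) has_derivative L) (at x)"
    unfolding L_def by (rule iffD1[OF frechet_derivative_works differentiableI[OF has_derivative_II_jets[OF x]]])
  have dII: "frechet_derivative (\<lambda>x. II x u v) (at x) = (\<lambda>h. L h * (u \<bullet> v))" for u v
  proof -
    have "((\<lambda>x. II x u v) has_derivative (\<lambda>h. L h * (u \<bullet> v))) (at x)"
      by (rule has_derivative_transform_within_open[OF has_derivative_mult_left[OF L] open_\<Omega> x])
        (rule \<rho>_conformal(2)[symmetric])
    from frechet_derivative_at[OF this] show ?thesis by (rule sym)
  qed
  have "(\<rho> has_derivative (\<lambda>h. of_real (L h / 2))) (at x)"
    by (rule has_derivative_transform_within_open[OF _ open_\<Omega> x \<rho>_conformal(1)[symmetric]])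
      (intro has_derivative_of_real bounded_linear.has_derivative[OF bounded_linear_divide L])
  then show ?thesis
  proof (rule has_wirtinger_of_has_derivative)
    note cod = codazzi[OF x, where u = 1 and v = \<i>, unfolded dII \<rho>_conformal(2)[OF x, of _ "conn I x _ _"]]
    have "L 1 = II x 1 1 * (Im (conn I x 1 \<i>) - Re (conn I x \<i> \<i>))
       - Re (c x) * a x * (I x \<i> \<i> * t1 1 x - I x 1 \<i> * t1 \<i> x)"
      using cod[of \<i>] by (simp add: c_eq inner_complex_def algebra_simps)
    then have L1: "complex_of_real (L 1) = of_real (II x 1 1 * (Im (conn I x 1 \<i>) - Re (conn I x \<i> \<i>))
       - Re (c x) * a x * (I x \<i> \<i> * t1 1 x - I x 1 \<i> * t1 \<i> x))"
      by (rule arg_cong)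
    have "- L \<i> - II x 1 1 * Im (conn I x 1 1) + II x 1 1 * Re (conn I x 1 \<i>)
        = - Re (c x) * a x * (I x 1 \<i> * t1 1 x - I x 1 1 * t1 \<i> x)"
      using cod[of 1] unfolding conn_symmetric[OF x, of \<i> 1] I_commute[of x \<i> 1]
      by (simp add: c_eq inner_complex_def)
    then have "L \<i> = II x 1 1 * (Re (conn I x 1 \<i>) - Im (conn I x 1 1))
       + Re (c x) * a x * (I x 1 \<i> * t1 1 x - I x 1 1 * t1 \<i> x)"
      by (simp add: algebra_simps)
    then have Li: "complex_of_real (L \<i>) = of_real (II x 1 1 * (Re (conn I x 1 \<i>) - Im (conn I x 1 1))
       + Re (c x) * a x * (I x 1 \<i> * t1 1 x - I x 1 1 * t1 \<i> x))"
      by (rule arg_cong)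
    show "\<nu> x * cnj (\<alpha> x) * c x - \<rho> x * (cnj (\<Gamma>112 x) - \<Gamma>111 x) =
      (complex_of_real (L 1 / 2) - \<i> * complex_of_real (L \<i> / 2)) / 2"
      "\<nu> x * \<alpha> x * c x - \<rho> x * (\<Gamma>112 x - \<Gamma>222 x) =
      (complex_of_real (L 1 / 2) + \<i> * complex_of_real (L \<i> / 2)) / 2"
      unfolding of_real_divide L1 Li
      by (simp_all add: \<alpha>_eq[OF x] hz_def E_eq F_eq \<nu>_eq c_eq \<rho>_conformal(1)[OF x] \<Gamma>_eq[OF x] complex_eq_iff field_simps)
  qed
qed

lemma has_wirtinger_D:
  assumes x: "x \<in> \<Omega>"
  shows "has_wirtinger D (2 * D x * (\<Gamma>111 x + cnj (\<Gamma>112 x))) (2 * D x * (cnj (\<Gamma>111 x) + \<Gamma>112 x)) x"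
proof -
  have "has_wirtinger (\<lambda>x. E x * cnj (E x) - F x * F x)
    (2 * D x * (\<Gamma>111 x + cnj (\<Gamma>112 x))) (2 * D x * (cnj (\<Gamma>111 x) + \<Gamma>112 x)) x"
    by (rule has_wirtinger_eq_rhs[OF has_wirtinger_diff[OF
          has_wirtinger_mult[OF has_wirtinger_E[OF x] has_wirtinger_cnj[OF has_wirtinger_E[OF x]]]
          has_wirtinger_mult[OF has_wirtinger_F[OF x] has_wirtinger_F[OF x]]]])
      (simp_all add: D_eq algebra_simps)
  then show ?thesis unfolding D_eq[abs_def] .
qed

text \<open>In the logarithmic zb-derivative of K, \<rho> contributes 2 (\<nu> \<alpha> c / \<rho> -
  \<Gamma>112 + \<Gamma>222) and D takes away 2 (\<open>cnj\<close> \<Gamma>111 + \<Gamma>112). The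
  symbols \<Gamma>222 and \<open>cnj\<close> \<Gamma>111 coincide, leaving -4 \<Gamma>112.\<close>

lemma has_wirtinger_K:
  assumes x: "x \<in> \<Omega>"
  shows "has_wirtinger K (cnj (4 * K x * (\<nu> x * \<alpha> x * c x / (2 * \<rho> x) - \<Gamma>112 x)))
    (4 * K x * (\<nu> x * \<alpha> x * c x / (2 * \<rho> x) - \<Gamma>112 x)) x"
proof -
  have "has_wirtinger (\<lambda>x. - (\<rho> x * \<rho> x) / D x)
    (cnj (4 * K x * (\<nu> x * \<alpha> x * c x / (2 * \<rho> x) - \<Gamma>112 x)))
    (4 * K x * (\<nu> x * \<alpha> x * c x / (2 * \<rho> x) - \<Gamma>112 x)) x"
    by (rule has_wirtinger_eq_rhs[OF has_wirtinger_divide[OF has_wirtinger_minus[OF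
          has_wirtinger_mult[OF has_wirtinger_\<rho>[OF x] has_wirtinger_\<rho>[OF x]]] has_wirtinger_D[OF x] D_nonzero[OF x]]])
      (use D_nonzero[OF x] \<rho>_nonzero[OF x] in
        \<open>simp_all add: K_eq[OF x] cnj_\<rho>[OF x] \<Gamma>_eq(4)[OF x] field_simps\<close>)
  then show ?thesis
    by (rule has_wirtinger_cong[OF _ open_\<Omega> x]) (simp add: K_eq)
qed

text \<open>Only the z-derivative is worked out: it also yields the zb-derivative of
  \<open>cnj\<close> \<alpha>, which the second derivative of \<nu> calls for. The other coefficient
  is merely named.\<close>

lemma has_wirtinger_\<alpha>:
  assumes x: "x \<in> \<Omega>"
  shows "has_wirtinger \<alpha>
    (\<alpha> x * (\<Gamma>111 x + 2 * cnj (\<Gamma>112 x)) - cnj (\<alpha> x) * \<Gamma>112 x + f1 x * (D x - \<alpha> x * hz x) - \<rho> x * F x * \<nu> x)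
    (Dzb \<alpha> x) x"
proof -
  have "has_wirtinger (\<lambda>x. cnj (E x) * hz x - F x * cnj (hz x)) A B x \<Longrightarrow> has_wirtinger \<alpha> A B x" for A B
    by (erule has_wirtinger_cong[OF _ open_\<Omega> x]) (simp add: \<alpha>_eq)
  note w = this[OF has_wirtinger_diff[OF
        has_wirtinger_mult[OF has_wirtinger_cnj[OF has_wirtinger_E[OF x]] has_wirtinger_hz[OF x]]
        has_wirtinger_mult[OF has_wirtinger_F[OF x] has_wirtinger_cnj[OF has_wirtinger_hz[OF x]]]]]
  show ?thesis
    by (rule has_wirtinger_eq_rhs[OF w _ has_wirtinger_Dz(2)[OF w, symmetric]])
      (simp add: \<alpha>_eq[OF x] D_eq cnj_\<rho>[OF x] power2_eq_square algebra_simps)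
qed

section \<open>The structure equations\<close>

lemma Dz_\<nu>:
  assumes x: "x \<in> \<Omega>"
  shows "Dz \<nu> x = cnj (\<alpha> x) * K x / \<rho> x - f1 x * \<nu> x * hz x"
  using has_wirtinger_Dz(1)[OF gradient(1)[OF x]] \<rho>_nonzero[OF x] D_nonzero[OF x]
  by (simp add: K_eq[OF x] field_simps)

lemma \<Gamma>112_eq:
  assumes x: "x \<in> \<Omega>"
  shows "\<Gamma>112 x = - Dzb K x / (4 * K x) + \<nu> x * \<alpha> x / (2 * \<rho> x) * c x"
  unfolding has_wirtinger_Dz(2)[OF has_wirtinger_K[OF x]] using K_eq(2)[OF x] \<rho>_nonzero[OF x]
  by (simp add: field_simps)

lemma Dz_K: "x \<in> \<Omega> \<Longrightarrow> Dz K x = cnj (Dzb K x)"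
  using has_wirtinger_Dz[OF has_wirtinger_K] by simp

text \<open>The curvature parts of \<Gamma>112 and its conjugate add up to \<nu> c / (2 \<rho>)
  times dh(T) D. This produces the factor 1 - \<nu>^2, and D = - \<rho>^2 / K moves K into the
  denominator.\<close>

theorem Dzb_Dz_h:
  assumes x: "x \<in> \<Omega>"
  shows "Dzb hz x = \<rho> x * \<nu> x * (1 - c x * (1 - (\<nu> x)\<^sup>2) / (2 * K x))
          - 1 / (4 * K x) * (Dzb K x * hz x + Dz K x * cnj (hz x))
          + f1 x * (F x - cnj (hz x) * hz x)"
proof -
  have "\<nu> x * c x / (2 * \<rho> x) * (hz x * \<alpha> x + cnj (hz x) * cnj (\<alpha> x))
      = - \<rho> x * \<nu> x * c x * (1 - (\<nu> x)\<^sup>2) / (2 * K x)"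
    unfolding gradient(2)[OF x] using D_nonzero[OF x] \<rho>_nonzero[OF x] by (simp add: K_eq(1)[OF x] field_simps)
  moreover have "\<Gamma>112 x * hz x + cnj (\<Gamma>112 x) * cnj (hz x)
      = - 1 / (4 * K x) * (Dzb K x * hz x + Dz K x * cnj (hz x))
        + \<nu> x * c x / (2 * \<rho> x) * (hz x * \<alpha> x + cnj (hz x) * cnj (\<alpha> x))"
    unfolding \<Gamma>112_eq[OF x] Dz_K[OF x] using K_eq(2)[OF x] \<rho>_nonzero[OF x]
    by (simp add: cnj_\<rho>[OF x] field_simps)
  ultimately have "\<Gamma>112 x * hz x + cnj (\<Gamma>112 x) * cnj (hz x)
      = - 1 / (4 * K x) * (Dzb K x * hz x + Dz K x * cnj (hz x))
        + - \<rho> x * \<nu> x * c x * (1 - (\<nu> x)\<^sup>2) / (2 * K x)"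
    by (simp only:)
  then show ?thesis
    unfolding has_wirtinger_Dz(2)[OF has_wirtinger_hz[OF x]]
    by (simp add: algebra_simps diff_divide_distrib add_divide_distrib)
qed

text \<open>In \<alpha> \<open>cnj\<close> \<Gamma>112 - \<open>cnj\<close> \<alpha> \<Gamma>112 the
  curvature parts are equal and cancel, so only derivatives of K are left.\<close>

theorem Dz_\<alpha>:
  assumes x: "x \<in> \<Omega>"
  shows "Dz \<alpha> x = \<alpha> x * (Dz D x / (2 * D x))
          + 1 / (4 * K x) * (cnj (\<alpha> x) * Dzb K x - \<alpha> x * Dz K x)
          - \<rho> x * F x * \<nu> x - f1 x * (\<alpha> x * hz x - D x)"
proof -
  have "Dz D x / (2 * D x) = \<Gamma>111 x + cnj (\<Gamma>112 x)"
    using has_wirtinger_Dz(1)[OF has_wirtinger_D[OF x]] D_nonzero[OF x] by simp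
  moreover have "1 / (4 * K x) * (cnj (\<alpha> x) * Dzb K x - \<alpha> x * Dz K x)
      = \<alpha> x * cnj (\<Gamma>112 x) - cnj (\<alpha> x) * \<Gamma>112 x"
    unfolding \<Gamma>112_eq[OF x] Dz_K[OF x] using K_eq(2)[OF x] \<rho>_nonzero[OF x]
    by (simp add: cnj_\<rho>[OF x] field_simps)
  ultimately show ?thesis
    unfolding has_wirtinger_Dz(1)[OF has_wirtinger_\<alpha>[OF x]] by (simp add: algebra_simps)
qed

text \<open>Differentiating the formula for \<nu>_z cancels \<Gamma>111, and the curvature parts
  cancel with weights 3/2 - 1/2 - 1. The derivative of \<open>cnj\<close> \<alpha> brings
  \<open>cnj\<close> \<alpha> h_zb; replacing \<nu>_zb h_z by \<nu>_z h_zb in the f' term trades it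
  for \<alpha> h_z.\<close>

theorem Dzb_Dz_\<nu>:
  assumes x: "x \<in> \<Omega>"
  shows "Dzb (Dz \<nu>) x = 1 / (4 * \<rho> x) * (cnj (\<alpha> x) * Dzb K x + \<alpha> x * Dz K x)
          - K x * F x * \<nu> x - K x * f1 x / \<rho> x * (\<alpha> x * hz x - D x)
          - f1 x * (Dz \<nu> x * cnj (hz x) + \<nu> x * Dzb hz x)
          - f2 x * \<nu> x * (hz x * cnj (hz x))"
proof -
  note wh = has_wirtinger_hz[OF x] and w\<nu> = gradient(1)[OF x] and w\<rho> = has_wirtinger_\<rho>[OF x]
    and wK = has_wirtinger_K[OF x] and wa = has_wirtinger_\<alpha>[OF x]
  note w = has_wirtinger_diff[OF
      has_wirtinger_divide[OF has_wirtinger_mult[OF has_wirtinger_cnj[OF wa] wK] w\<rho> \<rho>_nonzero[OF x]]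
      has_wirtinger_mult[OF has_wirtinger_mult[OF has_wirtinger_f1[OF x] w\<nu>] wh]]
  have "has_wirtinger (Dz \<nu>) A B x"
    if "has_wirtinger (\<lambda>x. cnj (\<alpha> x) * K x / \<rho> x - f1 x * \<nu> x * hz x) A B x" for A B
    using that by (rule has_wirtinger_cong[OF _ open_\<Omega> x]) (simp add: Dz_\<nu>)
  note 1 = has_wirtinger_Dz(2)[OF this[OF w]]
  show ?thesis
    unfolding 1 Dz_\<nu>[OF x] has_wirtinger_Dz(2)[OF wh] has_wirtinger_Dz[OF wK] \<Gamma>_eq(4)[OF x]
    using \<rho>_nonzero[OF x] D_nonzero[OF x]
    by (simp add: K_eq(1)[OF x] cnj_\<rho>[OF x] field_simps)
qed

theorem structure_equations:
  assumes x: "x \<in> \<Omega>"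
  shows "Dzb \<rho> x / \<rho> x + (\<Gamma>112 x - \<Gamma>222 x) = \<nu> x / \<rho> x * \<alpha> x * c x \<and>
      Dz \<nu> x = cnj (\<alpha> x) * K x / \<rho> x - f1 x * \<nu> x * Dz h x \<and>
      \<Gamma>112 x = - Dzb K x / (4 * K x) + \<nu> x * \<alpha> x / (2 * \<rho> x) * c x \<and>
      Dz (Dz h) x
        = \<Gamma>111 x * Dz h x + \<Gamma>211 x * Dzb h x + f1 x * E x - f1 x * (Dz h x)\<^sup>2 \<and>
      Dzb (Dz h) x
        = \<rho> x * \<nu> x * (1 - c x * (1 - (\<nu> x)\<^sup>2) / (2 * K x))
          - 1 / (4 * K x) * (Dzb K x * Dz h x + Dz K x * Dzb h x)
          + f1 x * (F x - Dzb h x * Dz h x) \<and>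
      Dz \<alpha> x
        = \<alpha> x * (Dz D x / (2 * D x))
          + 1 / (4 * K x) * (cnj (\<alpha> x) * Dzb K x - \<alpha> x * Dz K x)
          - \<rho> x * F x * \<nu> x - f1 x * (\<alpha> x * Dz h x - D x) \<and>
      Dzb (Dz \<nu>) x
        = 1 / (4 * \<rho> x) * (cnj (\<alpha> x) * Dzb K x + \<alpha> x * Dz K x)
          - K x * F x * \<nu> x - K x * f1 x / \<rho> x * (\<alpha> x * Dz h x - D x)
          - f1 x * (Dz \<nu> x * Dzb h x + \<nu> x * Dzb (Dz h) x)
          - f2 x * \<nu> x * complex_of_real ((cmod (Dz h x))\<^sup>2)"
proof -
  have hz: "Dz (Dz h) x = Dz hz x" "Dzb (Dz h) x = Dzb hz x"
    using Dz_cong[OF open_\<Omega> x, of "Dz h" hz] Dz_h(1) by blast+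
  have "Dzb \<rho> x / \<rho> x + (\<Gamma>112 x - \<Gamma>222 x) = \<nu> x / \<rho> x * \<alpha> x * c x"
    unfolding has_wirtinger_Dz(2)[OF has_wirtinger_\<rho>[OF x]] using \<rho>_nonzero[OF x] by (simp add: field_simps)
  moreover have "Dz hz x = \<Gamma>111 x * hz x + \<Gamma>211 x * cnj (hz x) + f1 x * E x - f1 x * (hz x)\<^sup>2"
    unfolding has_wirtinger_Dz(1)[OF has_wirtinger_hz[OF x]] by (simp add: algebra_simps)
  ultimately show ?thesis
    unfolding hz Dz_h[OF x] complex_norm_square
    by (intro conjI Dz_\<nu>[OF x] \<Gamma>112_eq[OF x] Dzb_Dz_h[OF x] Dz_\<alpha>[OF x] Dzb_Dz_\<nu>[OF x])
qed

end

text \<open>All equations are local: the image of the chart is a \<open>conformal_patch\<close>,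
  whose quantities are the given ones. In \<open>Dzb (Dz h)\<close> the f' term has a plus sign
  where the English equation has a minus; the Hessian f' (I - dh^2) + \<nu> II on (d_z, d_zb) forces
  it, in agreement with the sign in \<open>Dz (Dz h)\<close>.\<close>

theorem lemma3p2:
  fixes \<kappa> :: real and f :: "real \<Rightarrow> real"
    and A :: "'s::{t2_space, second_countable_topology} chart set"
    and \<phi> N :: "'s \<Rightarrow> ambient"
    and V :: "'s set" and z :: "'s \<Rightarrow> complex"
    and \<psi> n :: "complex \<Rightarrow> ambient"
    and I II :: "complex \<Rightarrow> complex \<Rightarrow> complex \<Rightarrow> real"
    and E F \<rho> h \<nu> Ke f1 f2 c D \<alpha> :: "complex \<Rightarrow> complex"
  assumes "\<kappa> \<in> {-1, 0, 1}"
    and "smooth_on UNIV f"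
    and "smooth_structure A"
    and "orientable_surface A"
    and "immersion \<kappa> A \<phi>"
    and "complete_surface \<kappa> f A \<phi>"
    and "unit_normal \<kappa> f A \<phi> N"
    and "positive_extrinsic_curvature \<kappa> f A \<phi> N"
    and "second_ff_pos_def \<kappa> f A \<phi> N"
    and "(V, z) \<in> A"
    and "conformal_parameter \<kappa> f \<phi> N (V, z)"
    and "\<psi> = in_chart (V, z) \<phi>"
    and "n = in_chart (V, z) N"
    and "I = first_ff \<kappa> f \<psi>"
    and "II = second_ff \<kappa> f \<psi> n"
    and "E = (\<lambda>x. ext2 (\<lambda>u v. complex_of_real (I x u v)) d_z d_z)"
    and "F = (\<lambda>x. ext2 (\<lambda>u v. complex_of_real (I x u v)) d_z d_zb)"
    and "\<rho> = (\<lambda>x. ext2 (\<lambda>u v. complex_of_real (II x u v)) d_z d_zb)"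
    and "h = (\<lambda>x. complex_of_real (height \<psi> x))"
    and "\<nu> = (\<lambda>x. complex_of_real (angle \<kappa> f \<psi> n x))"
    and "Ke = (\<lambda>x. complex_of_real (extrinsic_curvature \<kappa> f \<psi> n x))"
    and "f1 = (\<lambda>x. complex_of_real (deriv f (height \<psi> x)))"
    and "f2 = (\<lambda>x. complex_of_real (deriv (deriv f) (height \<psi> x)))"
    and "c = (\<lambda>x. f2 x + complex_of_real (\<kappa> * exp (- 2 * f (height \<psi> x))))"
    and "D = (\<lambda>x. complex_of_real ((cmod (E x))\<^sup>2) - (F x)\<^sup>2)"
    and "\<alpha> = (\<lambda>x. cnj (E x) * Dz h x - F x * Dzb h x)"
  shows "\<forall>x\<in>z ` V.
      Dzb \<rho> x / \<rho> x + (Gamma1 I d_z d_zb x - Gamma2 I d_zb d_zb x)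
        = \<nu> x / \<rho> x * \<alpha> x * c x \<and>
      Dz \<nu> x = cnj (\<alpha> x) * Ke x / \<rho> x - f1 x * \<nu> x * Dz h x \<and>
      Gamma1 I d_z d_zb x
        = - Dzb Ke x / (4 * Ke x) + \<nu> x * \<alpha> x / (2 * \<rho> x) * c x \<and>
      Dz (Dz h) x
        = Gamma1 I d_z d_z x * Dz h x + Gamma2 I d_z d_z x * Dzb h x
          + f1 x * E x - f1 x * (Dz h x)\<^sup>2 \<and>
      Dzb (Dz h) x
        = \<rho> x * \<nu> x * (1 - c x * (1 - (\<nu> x)\<^sup>2) / (2 * Ke x))
          - 1 / (4 * Ke x) * (Dzb Ke x * Dz h x + Dz Ke x * Dzb h x)
          + f1 x * (F x - Dzb h x * Dz h x) \<and>
      Dz \<alpha> x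
        = \<alpha> x * (Dz D x / (2 * D x))
          + 1 / (4 * Ke x) * (cnj (\<alpha> x) * Dzb Ke x - \<alpha> x * Dz Ke x)
          - \<rho> x * F x * \<nu> x - f1 x * (\<alpha> x * Dz h x - D x) \<and>
      Dzb (Dz \<nu>) x
        = 1 / (4 * \<rho> x) * (cnj (\<alpha> x) * Dzb Ke x + \<alpha> x * Dz Ke x)
          - Ke x * F x * \<nu> x - Ke x * f1 x / \<rho> x * (\<alpha> x * Dz h x - D x)
          - f1 x * (Dz \<nu> x * Dzb h x + \<nu> x * Dzb (Dz h) x)
          - f2 x * \<nu> x * complex_of_real ((cmod (Dz h x))\<^sup>2)"
proof -
  note kappa = assms(1) and smooth_f = assms(2) and atlas = assms(3)
    and imm = assms(5) and normal = assms(7) and chart = assms(10) and conf = assms(11)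
    and \<psi> = assms(12) and n = assms(13)
  have dom: "chart_dom (V, z) = z ` V" by (simp add: chart_dom_def)
  interpret P: conformal_patch \<kappa> f "z ` V" \<psi> n
  proof
    show "\<kappa> \<in> {-1, 0, 1}" "smooth_on UNIV f" by (fact kappa smooth_f)+
    show "open (z ` V)"
      using atlas chart unfolding smooth_structure_def smooth_atlas_def by fast
    show "smooth_on (z ` V) \<psi>" "smooth_on (z ` V) n"
      using imm normal chart unfolding immersion_def unit_normal_def smooth_map_def \<psi> n dom[symmetric]
      by blast+
    fix y assume y: "y \<in> z ` V"
    show "snd (\<psi> y) \<in> space_form \<kappa>"
      using imm unfolding immersion_def \<psi> in_chart_def by (simp add: mem_Times_iff)
    show "n y \<in> warped_tangent \<kappa> (\<psi> y)" "warped_metric \<kappa> f (\<psi> y) (n y) (n y) = 1"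
      using normal unfolding unit_normal_def \<psi> n in_chart_def by simp_all
    show "warped_metric \<kappa> f (\<psi> y) (n y) (frechet_derivative \<psi> (at y) u) = 0" for u
      using normal chart y unfolding unit_normal_def \<psi> n dom[symmetric] by blast
    show "inj (frechet_derivative \<psi> (at y))"
      using imm chart y unfolding immersion_def \<psi> dom[symmetric] by blast
    show "\<exists>r>0. \<forall>u v. second_ff \<kappa> f \<psi> n y u v = 2 * r * (u \<bullet> v)"
      using conf y unfolding conformal_parameter_def \<psi> n dom by blast
  qed
  note I = assms(14) and II = assms(15)
  have eqs: "E = P.E" "F = P.F" "\<rho> = P.\<rho>" "h = P.h" "\<nu> = P.\<nu>" "Ke = P.K" "f1 = P.f1" "f2 = P.f2"
    unfolding assms(16-23) I II
    by (simp_all only: fun_eq_iff P.E_def P.F_def P.\<rho>_def P.h_def P.\<nu>_def P.K_def P.f1_def P.f2_def simp_thms)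
  have "c = P.c" "D = P.D" "\<alpha> = P.\<alpha>"
    unfolding assms(24-26) eqs by (simp_all only: fun_eq_iff P.c_def P.D_def P.\<alpha>_def simp_thms)
  note eqs = eqs this
  show ?thesis
    unfolding eqs I by (rule ballI) (rule P.structure_equations)
qed

end
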